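(* Let $\alpha\in[0,1)$ be an irrational number with unbounded partial quotients $(a_n)_{n\ge1}$ and denominators $(q_n)_{n\ge0}$. Let $\beta\in(0,1)$, $\beta\notin\mathbb{Z}\alpha+\mathbb{Z}$, and suppose there is a sequence of integers $(b_n)_{n\ge0}$, with $b_n\neq0$ for $n\ge1$, such that $$\beta=\sum_{n\ge0}b_nq_n\alpha \bmod 1,\qquad \sum_{n\ge0}\frac{|b_n|}{a_{n+1}}<\infty,\qquad \sum_{n}\Big(\frac{b_n}{b_{n+1}}\Big)^2<\infty .$$ Then the $\mathbb{Z}$-valued cocycle over the rotation $R_\alpha$ generated by $\Phi_\beta$ is non-regular (and therefore the skew product $(x,r)\mapsto(x+\alpha,r+\Phi_\beta(x))$ on $\mathbb{T}\times\mathbb{Z}$ is not ergodic).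
   Context: $\mathbb{T}=[0,1)$ is the additive circle with Lebesgue measure $\mu$, $R_\alpha x=x+\alpha \bmod 1$. Denominators: $q_0=1$, $q_1=a_1$, $q_{n+1}=a_{n+1}q_n+q_{n-1}$. With $F=1_{[0,\frac12)}-1_{[\frac12,1)}$ (1-periodic), $\Phi_\beta(x)=\frac12F(x-\beta)-\frac12F(x)$, which takes values in $\{-1,0,1\}$. For a measurable $\Phi:X\to G$ ($G=\mathbb{Z}^d$ or $\mathbb{R}^d$) over an ergodic system $(X,\mu,T)$, $\Phi$ is a coboundary if $\Phi=g\circ T-g$ a.e. for some measurable $g:X\to G$; two cocycles are cohomologous if their difference is a coboundary. The cocycle $\Phi$ is regular if it is cohomologous to a cocycle $\Psi$ with values in a closed subgroup $G_0$ of $G$ such that $(x,h)\mapsto(Tx,h+\Psi(x))$ is ergodic on $X\times G_0$ for $\mu\otimes m_{G_0}$ ($m_{G_0}$ a Haar measure); otherwise it is non-regular. *)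

theory Defs
  imports "HOL-Probability.Probability"
begin

text \<open>With these instances, cocycles with values in \<open>\<int>\<close> (discrete) and in \<open>\<real>\<^sup>d\<close> are treated by the
  same definitions.\<close>

instance int :: topological_ab_group_add
  by standard (simp add: nhds_discrete filterlim_principal eventually_principal)

instance int :: second_countable_topology
proof
  have "open = generate_topology (range (\<lambda>n::int. {n}))"
  proof (intro ext iffI)
    fix S :: "int set"
    assume "open S"
    have "generate_topology (range (\<lambda>n::int. {n})) (\<Union>((\<lambda>n. {n}) ` S))"
      by (intro generate_topology.UN) (auto intro: generate_topology.Basis)
    then show "generate_topology (range (\<lambda>n::int. {n})) S" by simp
  qed (rule Topological_Spaces.open_discrete)
  then show "\<exists>B :: int set set. countable B \<and> open = generate_topology B"
    by (intro exI[of _ "range (\<lambda>n::int. {n})"]) simp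
qed

section \<open>Cocycles over a measure-preserving system\<close>

definition skew_product :: "('x \<Rightarrow> 'x) \<Rightarrow> ('x \<Rightarrow> 'g::plus) \<Rightarrow> 'x \<times> 'g \<Rightarrow> 'x \<times> 'g" where
  "skew_product T \<Psi> = (\<lambda>(x, h). (T x, h + \<Psi> x))"

text \<open>Triviality of the invariant sets. The measure may be infinite, so both alternatives are
  phrased with null sets. The predicate is only applied to skew products, with measurable cocycle,
  of a measure-preserving map; these preserve the product measure.\<close>

definition ergodic :: "'x measure \<Rightarrow> ('x \<Rightarrow> 'x) \<Rightarrow> bool" where
  "ergodic M T \<longleftrightarrow>
     (\<forall>A\<in>sets M. T -` A \<inter> space M = A \<longrightarrow>
        emeasure M A = 0 \<or> emeasure M (space M - A) = 0)"

definition coboundary ::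
  "'x measure \<Rightarrow> ('x \<Rightarrow> 'x) \<Rightarrow> ('x \<Rightarrow> 'g::{second_countable_topology, topological_ab_group_add}) \<Rightarrow> bool"
where
  "coboundary M T \<Phi> \<longleftrightarrow> (\<exists>g\<in>borel_measurable M. AE x in M. \<Phi> x = g (T x) - g x)"

definition cohomologous ::
  "'x measure \<Rightarrow> ('x \<Rightarrow> 'x) \<Rightarrow> ('x \<Rightarrow> 'g::{second_countable_topology, topological_ab_group_add}) \<Rightarrow> ('x \<Rightarrow> 'g) \<Rightarrow> bool"
where
  "cohomologous M T \<Phi> \<Psi> \<longleftrightarrow> coboundary M T (\<lambda>x. \<Phi> x - \<Psi> x)"

definition closed_subgroup :: "'g::{second_countable_topology, topological_ab_group_add} set \<Rightarrow> bool" where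
  "closed_subgroup H \<longleftrightarrow>
     closed H \<and> 0 \<in> H \<and> (\<forall>x\<in>H. \<forall>y\<in>H. x + y \<in> H) \<and> (\<forall>x\<in>H. - x \<in> H)"

definition haar_measure_on ::
  "'g::{second_countable_topology, topological_ab_group_add} set \<Rightarrow> 'g measure \<Rightarrow> bool"
where
  "haar_measure_on H m \<longleftrightarrow>
     space m = H \<and> sets m = sets (restrict_space borel H) \<and>
     emeasure m H \<noteq> 0 \<and>
     (\<forall>K. compact K \<and> K \<subseteq> H \<longrightarrow> emeasure m K < \<infinity>) \<and>
     (\<forall>h\<in>H. \<forall>A\<in>sets m. emeasure m ((+) h ` A) = emeasure m A)"

definition regular_cocycle ::
  "'x measure \<Rightarrow> ('x \<Rightarrow> 'x) \<Rightarrow> ('x \<Rightarrow> 'g::{second_countable_topology, topological_ab_group_add}) \<Rightarrow> bool"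
where
  "regular_cocycle M T \<Phi> \<longleftrightarrow>
     (\<exists>\<Psi>\<in>borel_measurable M. \<exists>H m.
        cohomologous M T \<Phi> \<Psi> \<and>
        closed_subgroup H \<and> (\<forall>x\<in>space M. \<Psi> x \<in> H) \<and>
        haar_measure_on H m \<and>
        ergodic (M \<Otimes>\<^sub>M m) (skew_product T \<Psi>))"


section \<open>Rotations of the circle\<close>

definition circle :: "real measure" where
  "circle = restrict_space lborel {0..<1}"

definition rotation :: "real \<Rightarrow> real \<Rightarrow> real" where
  "rotation \<alpha> x = frac (x + \<alpha>)"

text \<open>Convergence of a series in \<open>\<real>/\<int>\<close>, whose metric is the distance to the nearest integer;
  the partial sums need not converge in \<open>\<real>\<close>.\<close>

definition sums_mod_1 :: "(nat \<Rightarrow> real) \<Rightarrow> real \<Rightarrow> bool" where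
  "sums_mod_1 f s \<longleftrightarrow> (\<lambda>N. infdist ((\<Sum>n<N. f n) - s) \<int>) \<longlonglongrightarrow> 0"


section \<open>Continued fractions\<close>

primrec complete_quotient :: "real \<Rightarrow> nat \<Rightarrow> real" where
  "complete_quotient \<alpha> 0 = \<alpha>"
| "complete_quotient \<alpha> (Suc n) = 1 / frac (complete_quotient \<alpha> n)"

definition partial_quotient :: "real \<Rightarrow> nat \<Rightarrow> int" where
  "partial_quotient \<alpha> n = \<lfloor>complete_quotient \<alpha> n\<rfloor>"

fun cf_denom :: "real \<Rightarrow> nat \<Rightarrow> int" where
  "cf_denom \<alpha> 0 = 1"
| "cf_denom \<alpha> (Suc 0) = partial_quotient \<alpha> 1"
| "cf_denom \<alpha> (Suc (Suc n)) =
     partial_quotient \<alpha> (Suc (Suc n)) * cf_denom \<alpha> (Suc n) + cf_denom \<alpha> n"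


section \<open>The step cocycle\<close>

definition step_F :: "real \<Rightarrow> int" where
  "step_F x = (if frac x < 1/2 then 1 else - 1)"

text \<open>The difference is even, so \<open>div\<close> is exact; see the next lemma.\<close>

definition step_cocycle :: "real \<Rightarrow> real \<Rightarrow> int" where
  "step_cocycle \<beta> x = (step_F (x - \<beta>) - step_F x) div 2"

lemma of_int_step_cocycle:
  "real_of_int (step_cocycle \<beta> x) =
     1/2 * real_of_int (step_F (x - \<beta>)) - 1/2 * real_of_int (step_F x)"
  by (simp add: step_cocycle_def step_F_def)

end

theory Submission
  imports Defs
begin

text \<open>
  Write \<open>m\<^sub>N = \<Sum>n<N. b\<^sub>n q\<^sub>n\<close>. The function \<open>F(x - m\<^sub>N \<alpha>) - F(x)\<close> is a coboundary with transfer function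
  \<open>- \<Sum>n<N. \<delta>\<^sub>n\<close>, where \<open>\<delta>\<^sub>n\<close> is a Birkhoff sum of \<open>F\<close> of length \<open>b\<^sub>n q\<^sub>n\<close>. As \<open>q\<^sub>n \<alpha>\<close> is very close to an integer,
  \<open>\<delta>\<^sub>n\<close> equals \<open>b\<^sub>n s\<^sub>n\<close> off a set of measure \<open>O(\<bar>b\<^sub>n\<bar> / a\<^sub>n\<^sub>+\<^sub>1)\<close>, where \<open>s\<^sub>n\<close> takes values in \<open>{- 1, 0, 1}\<close> and, for odd
  \<open>q\<^sub>n\<close>, changes sign under translation by \<open>1 / (2 q\<^sub>n)\<close>. By Borel--Cantelli almost every point is eventually
  good.

  Suppose the cocycle is cohomologous, with transfer function \<open>g\<close>, to an ergodic \<open>\<Psi>\<close>. Let \<open>A\<close> be a set of positive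
  measure on which \<open>g\<close> is bounded and goodness is uniform. When a point of \<open>A\<close> returns to \<open>A\<close> with
  vanishing sum of \<open>\<Psi>\<close>, the sum of the cocycle is bounded; since \<open>b\<^sub>n / b\<^sub>n\<^sub>+\<^sub>1 \<rightarrow> 0\<close>, this forces
  \<open>s\<^sub>n\<close> to be preserved for all \<open>n \<ge> n\<^sub>1\<close>, with \<open>n\<^sub>1\<close> depending only on \<open>A\<close>. By ergodicity \<open>s\<^sub>n\<close> is then
  constant on \<open>A\<close>, which contradicts the sign change, because \<open>A\<close> meets its small translates in positive
  measure and infinitely many \<open>q\<^sub>n\<close> are odd.
\<close>

section \<open>Parity sums\<close>

definition par_sign :: "int \<Rightarrow> int" where
  "par_sign k = (if even k then 1 else - 1)"

text \<open>This is the sum of \<open>step_F\<close> over the points \<open>x - r / q\<close>, for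
  any x such that k is the integer part of \<open>2 * q * x\<close>.\<close>

definition par_sum :: "int \<Rightarrow> int \<Rightarrow> int" where
  "par_sum q k = (\<Sum>r\<in>{0..<q}. par_sign ((k - 2 * r) div q))"

lemma par_sign_div_add:
  assumes "q > 0" shows "par_sign ((k + q) div q) = - par_sign (k div q)"
  using assms by (simp add: par_sign_def)

lemma par_sign_div_period:
  assumes "q > 0" shows "par_sign ((k + 2 * q * t) div q) = par_sign (k div q)"
proof -
  have "(k + 2 * q * t) div q = (k + (2 * t) * q) div q" by (simp add: mult_ac)
  also have "\<dots> = 2 * t + k div q" using assms by (subst div_mult_self1) auto
  finally show ?thesis by (simp add: par_sign_def)
qed

lemma telescope_int:
  fixes f :: "int \<Rightarrow> 'a::ab_group_add"
  assumes "a \<le> b" shows "(\<Sum>i\<in>{a..<b}. f i - f (i + 1)) = f a - f b"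
  using assms
proof (induction b rule: int_ge_induct)
  case (step b)
  have "{a..<b+1} = insert b {a..<b}" using step by auto
  then show ?case using step by simp
qed simp

text \<open>Raising k by 2 shifts the summation index by one, so the difference telescopes. Its end
  terms \<open>?f 0\<close> and \<open>?f q\<close> agree by the period \<open>2 * q\<close> of the
  parity.\<close>

lemma par_sum_add_2:
  assumes "q > 0" shows "par_sum q (k + 2) = par_sum q k"
proof -
  let ?f = "\<lambda>i. par_sign ((k + 2 - 2 * i) div q)"
  have "par_sum q (k + 2) - par_sum q k = (\<Sum>i\<in>{0..<q}. ?f i - ?f (i + 1))"
    by (simp add: par_sum_def sum_subtractf algebra_simps)
  also have "\<dots> = ?f 0 - ?f q" using assms by (intro telescope_int) simp
  also have "?f 0 = ?f q"
    using par_sign_div_period[OF assms, of "k + 2 - 2 * q" 1] by simp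
  finally show ?thesis by simp
qed

lemma par_sum_period:
  assumes "q > 0" shows "par_sum q (k + 2 * t) = par_sum q k"
proof (induction t rule: int_induct[where k = 0])
  case (step1 i) then show ?case using par_sum_add_2[OF assms, of "k + 2 * i"] by (simp add: algebra_simps)
next
  case (step2 i) then show ?case using par_sum_add_2[OF assms, of "k + 2 * (i - 1)"] by (simp add: algebra_simps)
qed simp

lemma par_sum_add_q:
  assumes "q > 0" shows "par_sum q (k + q) = - par_sum q k"
proof -
  have "par_sign ((k + q - 2 * r) div q) = - par_sign ((k - 2 * r) div q)" for r
    using par_sign_div_add[OF assms, of "k - 2 * r"] by (simp add: algebra_simps)
  then show ?thesis by (simp add: par_sum_def sum_negf)
qed

text \<open>An even q is a multiple of the period 2, while translation by q changes the sign, so the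
  sum equals its own negative.\<close>

lemma par_sum_even:
  assumes "q > 0" "even q" shows "par_sum q k = 0"
proof -
  from assms(2) obtain t where "q = 2 * t" by blast
  then have "par_sum q (k + q) = par_sum q k" using par_sum_period[OF assms(1)] by simp
  with par_sum_add_q[OF assms(1)] show ?thesis by simp
qed

text \<open>For odd q and 0 < r < q, q does not divide \<open>2 * r\<close>, so the quotients of
  \<open>2 * r\<close> and \<open>- 2 * r\<close> add up to -1 and have opposite parity. The
  reflection of r to \<open>q - r\<close> therefore cancels everything except the term r =
  0.\<close>

lemma par_sum_0_odd:
  assumes "q > 0" "odd q" shows "par_sum q 0 = 1"
proof -
  let ?g = "\<lambda>r. par_sign ((- 2 * r) div q)"
  have pair: "?g (q - r) = - ?g r" if "r \<in> {1..<q}" for r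
  proof -
    have "\<not> q dvd 2 * r"
    proof
      assume "q dvd 2 * r"
      moreover have "coprime q 2" using assms(2) by simp
      ultimately have "q dvd r" using coprime_dvd_mult_right_iff by blast
      then show False using that zdvd_imp_le by fastforce
    qed
    then have *: "(- (2 * r)) div q = - (2 * r div q) - 1"
      using assms(1) by (auto simp: zdiv_zminus1_eq_if dvd_eq_mod_eq_0)
    have "?g (q - r) = par_sign (2 * r div q)"
      using par_sign_div_period[OF assms(1), of "2 * r" "-1"] by (simp add: algebra_simps)
    then show ?thesis using * by (simp add: par_sign_def)
  qed
  have "(\<Sum>r\<in>{1..<q}. ?g r) = (\<Sum>r\<in>{1..<q}. ?g (q - r))"
    by (rule sum.reindex_bij_witness[of _ "\<lambda>r. q - r" "\<lambda>r. q - r"]) auto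
  also have "\<dots> = - (\<Sum>r\<in>{1..<q}. ?g r)" using pair by (simp add: sum_negf)
  finally have "(\<Sum>r\<in>{1..<q}. ?g r) = 0" by simp
  moreover have "{0..<q} = insert 0 {1..<q}" using assms(1) by auto
  ultimately show ?thesis by (simp add: par_sum_def par_sign_def)
qed

text \<open>An odd k differs from q by an even number, so the period 2 and the antisymmetry under q
  reduce both parities to k = 0. Neighbouring k thus give opposite signs, which is the source of the
  sign change of s_n.\<close>

lemma par_sum_odd:
  assumes "q > 0" "odd q" shows "par_sum q k = par_sign k"
proof (cases "even k")
  case True
  then obtain t where "k = 2 * t" by blast
  then show ?thesis using par_sum_period[OF assms(1), of 0 t] par_sum_0_odd[OF assms]
    by (simp add: par_sign_def)
next
  case False
  with assms(2) have "even (k - q)" by simp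
  then obtain t where t: "k - q = 2 * t" by blast
  have "par_sum q k = par_sum q (0 + q + 2 * t)" using t by (simp add: algebra_simps)
  also have "\<dots> = - 1"
    unfolding par_sum_period[OF assms(1)] par_sum_add_q[OF assms(1)] par_sum_0_odd[OF assms] ..
  finally show ?thesis using False by (simp add: par_sign_def)
qed

lemma abs_par_sum_le_1:
  assumes "q > 0" shows "\<bar>par_sum q k\<bar> \<le> 1"
  using par_sum_even[OF assms] par_sum_odd[OF assms] by (cases "even q") (auto simp: par_sign_def)

text \<open>Multiplication by p permutes the residues modulo q, and reducing \<open>j * p\<close>
  modulo q changes the dividend by a multiple of \<open>2 * q\<close>, a period of the
  parity.\<close>

lemma sum_par_sign_coprime:
  assumes "q > 0" "coprime p q"
  shows "(\<Sum>j\<in>{1..q}. par_sign ((k - 2 * j * p) div q)) = par_sum q k"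
proof -
  let ?m = "\<lambda>j. (j * p) mod q"
  have inj: "inj_on ?m {1..q}"
  proof (rule inj_onI)
    fix i j assume ij: "i \<in> {1..q}" "j \<in> {1..q}" "?m i = ?m j"
    then have "q dvd (i - j) * p" by (simp add: mod_eq_dvd_iff left_diff_distrib)
    then have "q dvd i - j" using assms(2) coprime_commute coprime_dvd_mult_left_iff by blast
    then have "q dvd \<bar>i - j\<bar>" by simp
    moreover have "\<bar>i - j\<bar> < q" using ij by auto
    ultimately have "\<not> 0 < \<bar>i - j\<bar>" using zdvd_not_zless by blast
    then show "i = j" by simp
  qed
  have "?m ` {1..q} = {0..<q}"
  proof (rule card_subset_eq)
    show "?m ` {1..q} \<subseteq> {0..<q}" using assms(1) by auto
    show "card (?m ` {1..q}) = card {0..<q}" using card_image[OF inj] by simp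
  qed simp
  then have "par_sum q k = (\<Sum>r\<in>?m ` {1..q}. par_sign ((k - 2 * r) div q))"
    by (simp add: par_sum_def)
  also have "\<dots> = (\<Sum>j\<in>{1..q}. par_sign ((k - 2 * ?m j) div q))"
    by (simp add: sum.reindex[OF inj])
  also have "\<dots> = (\<Sum>j\<in>{1..q}. par_sign ((k - 2 * j * p) div q))"
  proof (rule sum.cong)
    fix j
    have "?m j = j * p - q * (j * p div q)" by (simp add: minus_mult_div_eq_mod)
    then have "k - 2 * ?m j = k - 2 * j * p + 2 * q * (j * p div q)" by (simp add: right_diff_distrib)
    then show "par_sign ((k - 2 * ?m j) div q) = par_sign ((k - 2 * j * p) div q)"
      using par_sign_div_period[OF assms(1)] by metis
  qed simp
  finally show ?thesis by simp
qed

section \<open>Birkhoff sums of the step function\<close>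

lemma step_F_eq_par_sign: "step_F x = par_sign \<lfloor>2 * x\<rfloor>"
proof (cases "frac x < 1/2")
  case True
  then have "\<lfloor>2 * x\<rfloor> = 2 * \<lfloor>x\<rfloor>" unfolding frac_def by linarith
  then show ?thesis using True by (simp add: step_F_def par_sign_def)
next
  case False
  then have "\<lfloor>2 * x\<rfloor> = 2 * \<lfloor>x\<rfloor> + 1" unfolding frac_def by linarith
  then show ?thesis using False by (simp add: step_F_def par_sign_def)
qed

lemma abs_step_F [simp]: "\<bar>step_F x\<bar> = 1"
  by (simp add: step_F_def)

lemma step_F_add_int: "step_F (x + of_int k) = step_F x"
  by (simp add: step_F_def frac_def)

definition birkhoff_F :: "real \<Rightarrow> int \<Rightarrow> real \<Rightarrow> int" where
  "birkhoff_F \<alpha> q x = (\<Sum>j\<in>{1..q}. step_F (x - of_int j * \<alpha>))"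

text \<open>For negative \<open>b\<close> the orbit is followed backwards, so that the cohomological equation
  \<open>transfer_F_step\<close> holds for both signs.\<close>

definition transfer_F :: "real \<Rightarrow> int \<Rightarrow> int \<Rightarrow> real \<Rightarrow> int" where
  "transfer_F \<alpha> q b x =
     (if 0 \<le> b then \<Sum>i\<in>{0..<b}. birkhoff_F \<alpha> q (x - of_int (i * q) * \<alpha>)
      else - (\<Sum>i\<in>{b..<0}. birkhoff_F \<alpha> q (x - of_int (i * q) * \<alpha>)))"

lemma birkhoff_F_step:
  assumes "q \<ge> 0"
  shows "birkhoff_F \<alpha> q (x + \<alpha>) - birkhoff_F \<alpha> q x = step_F x - step_F (x - of_int q * \<alpha>)"
proof -
  let ?f = "\<lambda>j. step_F (x + \<alpha> - of_int j * \<alpha>)"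
  have "birkhoff_F \<alpha> q (x + \<alpha>) - birkhoff_F \<alpha> q x = (\<Sum>j\<in>{1..<q+1}. ?f j - ?f (j + 1))"
    unfolding birkhoff_F_def sum_subtractf[symmetric]
    by (rule sum.cong) (auto simp: algebra_simps)
  also have "\<dots> = ?f 1 - ?f (q + 1)" using assms by (intro telescope_int) simp
  finally show ?thesis by (simp add: algebra_simps)
qed

lemma transfer_F_step:
  assumes "q \<ge> 0"
  shows "transfer_F \<alpha> q b (x + \<alpha>) - transfer_F \<alpha> q b x = step_F x - step_F (x - of_int (b * q) * \<alpha>)"
proof -
  let ?f = "\<lambda>i. step_F (x - of_int (i * q) * \<alpha>)"
  have *: "birkhoff_F \<alpha> q (x + \<alpha> - of_int (i * q) * \<alpha>) - birkhoff_F \<alpha> q (x - of_int (i * q) * \<alpha>) = ?f i - ?f (i + 1)" for i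
    using birkhoff_F_step[OF assms, of \<alpha> "x - of_int (i * q) * \<alpha>"] by (simp add: algebra_simps)
  show ?thesis
  proof (cases "0 \<le> b")
    case True
    then have "transfer_F \<alpha> q b (x + \<alpha>) - transfer_F \<alpha> q b x = (\<Sum>i\<in>{0..<b}. ?f i - ?f (i + 1))"
      by (simp only: transfer_F_def if_True sum_subtractf[symmetric] *)
    also have "\<dots> = ?f 0 - ?f b" using True by (rule telescope_int)
    finally show ?thesis by simp
  next
    case False
    then have "transfer_F \<alpha> q b (x + \<alpha>) - transfer_F \<alpha> q b x =
      - ((\<Sum>i\<in>{b..<0}. birkhoff_F \<alpha> q (x + \<alpha> - of_int (i * q) * \<alpha>))
         - (\<Sum>i\<in>{b..<0}. birkhoff_F \<alpha> q (x - of_int (i * q) * \<alpha>)))"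
      by (simp add: transfer_F_def)
    also have "\<dots> = - (\<Sum>i\<in>{b..<0}. ?f i - ?f (i + 1))"
      by (simp only: * sum_subtractf[symmetric])
    also have "\<dots> = - (?f b - ?f 0)" using False by (subst telescope_int) auto
    finally show ?thesis by simp
  qed
qed

lemma transfer_F_add_int: "transfer_F \<alpha> q b (x + of_int k) = transfer_F \<alpha> q b x"
proof -
  have "step_F (x + of_int k - c) = step_F (x - c)" for x c
    using step_F_add_int[of "x - c" k] by (simp add: algebra_simps)
  then have "birkhoff_F \<alpha> q (x + of_int k - c) = birkhoff_F \<alpha> q (x - c)" for c
    by (simp add: birkhoff_F_def diff_diff_eq)
  then show ?thesis by (simp add: transfer_F_def)
qed

text \<open>This crude bound serves the finitely many indices at which a point need not be
  good.\<close>

lemma abs_transfer_F_le: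
  assumes "q \<ge> 0" shows "\<bar>transfer_F \<alpha> q b x\<bar> \<le> \<bar>b\<bar> * q"
proof -
  have *: "\<bar>birkhoff_F \<alpha> q y\<bar> \<le> q" for y
    unfolding birkhoff_F_def using assms by (intro order_trans[OF sum_abs]) simp
  have "\<bar>\<Sum>i\<in>I. birkhoff_F \<alpha> q (y i)\<bar> \<le> int (card I) * q" for y :: "int \<Rightarrow> real" and I :: "int set"
    using * by (intro order_trans[OF sum_abs] sum_bounded_above) auto
  from this[where I = "{0..<b}"] this[where I = "{b..<0}"] show ?thesis
    by (auto simp: transfer_F_def)
qed

text \<open>Since \<open>step_F y\<close> is the parity of \<open>\<lfloor>2 * y\<rfloor>\<close> and \<open>\<alpha>\<close> is close to \<open>p / q\<close>, all the values of
  \<open>step_F\<close> occurring here are determined by the single integer \<open>\<lfloor>2 * q * x\<rfloor>\<close>.\<close>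

lemma birkhoff_F_eq_par_sum:
  fixes \<alpha> \<epsilon> x :: real and b p q :: int
  assumes q: "q > 0" "coprime p q"
    and eps: "2 * q * (1 + \<bar>b\<bar>) * \<bar>q * \<alpha> - p\<bar> \<le> \<epsilon>" "\<epsilon> < frac (2 * q * x)" "frac (2 * q * x) < 1 - \<epsilon>"
    and i: "\<bar>i\<bar> \<le> \<bar>b\<bar>"
  shows "birkhoff_F \<alpha> q (x - of_int (i * q) * \<alpha>) = par_sum q \<lfloor>2 * q * x\<rfloor>"
proof -
  have "step_F (x - of_int (i * q) * \<alpha> - of_int j * \<alpha>) = par_sign ((\<lfloor>2 * q * x\<rfloor> - 2 * j * p) div q)"
    if j: "j \<in> {1..q}" for j
  proof -
    define \<theta> where "\<theta> = q * \<alpha> - p"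
    \<comment> \<open>\<open>t\<close> is the displacement caused by replacing p / q by \<alpha>:
      the orbit point multiplied by \<open>2 * q\<close> is
      \<open>2 * q * x + t - 2 * (i * q + j) * p\<close>.\<close>
    define t where "t = - (2 * (real_of_int (i * q + j) * \<theta>))"
    have "\<bar>i * q + j\<bar> \<le> \<bar>i\<bar> * q + j"
      using j q(1) by (intro order_trans[OF abs_triangle_ineq]) (simp add: abs_mult)
    also have "\<dots> \<le> \<bar>b\<bar> * q + q" using i j q(1) by (intro add_mono mult_right_mono) auto
    finally have "real_of_int \<bar>i * q + j\<bar> \<le> real_of_int (q * (1 + \<bar>b\<bar>))"
      unfolding of_int_le_iff by (simp add: algebra_simps)
    then have "real_of_int \<bar>i * q + j\<bar> * \<bar>\<theta>\<bar> \<le> real_of_int (q * (1 + \<bar>b\<bar>)) * \<bar>\<theta>\<bar>"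
      by (rule mult_right_mono) simp
    moreover have "\<bar>t\<bar> = 2 * (real_of_int \<bar>i * q + j\<bar> * \<bar>\<theta>\<bar>)"
      unfolding t_def abs_minus_cancel abs_mult of_int_abs by simp
    moreover have "2 * (real_of_int (q * (1 + \<bar>b\<bar>)) * \<bar>\<theta>\<bar>) \<le> \<epsilon>"
      using eps(1) unfolding \<theta>_def[symmetric] by simp
    ultimately have "\<bar>t\<bar> \<le> \<epsilon>" by linarith
    \<comment> \<open>\<open>2 * q * x\<close> is further than \<epsilon> from every integer, so a
      displacement of at most \<epsilon> crosses none.\<close>
    then have fl: "\<lfloor>2 * q * x + t\<rfloor> = \<lfloor>2 * q * x\<rfloor>"
      using eps(2,3) unfolding frac_def by linarith
    have \<alpha>: "\<alpha> = (\<theta> + p) / q" using q(1) by (simp add: \<theta>_def)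
    have "2 * (x - of_int (i * q) * \<alpha> - of_int j * \<alpha>) =
        (2 * q * x + t - of_int (2 * j * p)) / of_int q - of_int (2 * i * p)"
      using q(1) unfolding \<alpha> t_def by (simp add: field_simps)
    also have "\<lfloor>\<dots>\<rfloor> = (\<lfloor>2 * q * x + t - of_int (2 * j * p)\<rfloor>) div q - 2 * i * p"
      using q(1) by (simp only: floor_diff_of_int floor_divide_real_eq_div[OF less_imp_le[OF q(1)]])
    also have "\<dots> = (\<lfloor>2 * q * x\<rfloor> - 2 * j * p) div q - 2 * i * p"
      unfolding floor_diff_of_int fl ..
    \<comment> \<open>The summand \<open>2 * i * p\<close> is even and disappears from the parity,
      so every block i has the same value.\<close>
    finally show ?thesis unfolding step_F_eq_par_sign by (simp add: par_sign_def)
  qed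
  then have "birkhoff_F \<alpha> q (x - of_int (i * q) * \<alpha>)
      = (\<Sum>j\<in>{1..q}. par_sign ((\<lfloor>2 * q * x\<rfloor> - 2 * j * p) div q))"
    by (simp add: birkhoff_F_def)
  then show ?thesis using sum_par_sign_coprime[OF q] by simp
qed

lemma transfer_F_eq_par_sum:
  fixes \<alpha> \<epsilon> x :: real and b p q :: int
  assumes "q > 0" "coprime p q"
    and "2 * q * (1 + \<bar>b\<bar>) * \<bar>q * \<alpha> - p\<bar> \<le> \<epsilon>" "\<epsilon> < frac (2 * q * x)" "frac (2 * q * x) < 1 - \<epsilon>"
  shows "transfer_F \<alpha> q b x = b * par_sum q \<lfloor>2 * q * x\<rfloor>"
proof -
  note * = birkhoff_F_eq_par_sum[OF assms]
  show ?thesis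
  proof (cases "0 \<le> b")
    case True
    then have "(\<Sum>i\<in>{0..<b}. birkhoff_F \<alpha> q (x - of_int (i * q) * \<alpha>)) = (\<Sum>i\<in>{0..<b}. par_sum q \<lfloor>2 * q * x\<rfloor>)"
      by (intro sum.cong[OF refl] *) auto
    then show ?thesis using True by (simp add: transfer_F_def)
  next
    case False
    then have "(\<Sum>i\<in>{b..<0}. birkhoff_F \<alpha> q (x - of_int (i * q) * \<alpha>)) = (\<Sum>i\<in>{b..<0}. par_sum q \<lfloor>2 * q * x\<rfloor>)"
      by (intro sum.cong[OF refl] *) auto
    then show ?thesis using False by (simp add: transfer_F_def)
  qed
qed

section \<open>Convergents\<close>

fun cf_numer :: "real \<Rightarrow> nat \<Rightarrow> int" where
  "cf_numer \<alpha> 0 = partial_quotient \<alpha> 0"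
| "cf_numer \<alpha> (Suc 0) = partial_quotient \<alpha> 1 * partial_quotient \<alpha> 0 + 1"
| "cf_numer \<alpha> (Suc (Suc n)) =
     partial_quotient \<alpha> (Suc (Suc n)) * cf_numer \<alpha> (Suc n) + cf_numer \<alpha> n"

context
  fixes \<alpha> :: real
  assumes irrational: "\<alpha> \<notin> \<rat>"
begin

lemma complete_quotient_irrational: "complete_quotient \<alpha> n \<notin> \<rat>"
proof (induction n)
  case (Suc n)
  show ?case
  proof
    assume "complete_quotient \<alpha> (Suc n) \<in> \<rat>"
    then have "inverse (complete_quotient \<alpha> (Suc n)) \<in> \<rat>" by (rule Rats_inverse)
    then have "frac (complete_quotient \<alpha> n) + of_int \<lfloor>complete_quotient \<alpha> n\<rfloor> \<in> \<rat>"
      by (intro Rats_add) auto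
    with Suc show False by (simp add: frac_def)
  qed
qed (use irrational in simp)

lemma frac_complete_quotient_pos: "0 < frac (complete_quotient \<alpha> n)"
  using complete_quotient_irrational[of n] Ints_subset_Rats by (auto simp: frac_gt_0_iff)

lemma complete_quotient_gt_1: "1 < complete_quotient \<alpha> (Suc n)"
  using frac_complete_quotient_pos[of n] frac_lt_1[of "complete_quotient \<alpha> n"] by simp

lemma partial_quotient_ge_1: "1 \<le> partial_quotient \<alpha> (Suc n)"
  using complete_quotient_gt_1[of n] unfolding partial_quotient_def by linarith

lemma cf_denom_pos: "0 < cf_denom \<alpha> n"
proof (induction n rule: induct_nat_012)
  case 1 then show ?case using partial_quotient_ge_1[of 0] by simp
next
  case (ge2 n)
  then show ?case using partial_quotient_ge_1[of "Suc n"] by (simp add: add_nonneg_pos)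
qed simp

text \<open>Linear growth is enough to make the half-cell translations by 1 / (2 q_n) arbitrarily
  small.\<close>

lemma cf_denom_ge: "int n \<le> cf_denom \<alpha> n"
proof (induction n rule: induct_nat_012)
  case 1 then show ?case using partial_quotient_ge_1[of 0] by simp
next
  case (ge2 n)
  have "1 * cf_denom \<alpha> (Suc n) \<le> partial_quotient \<alpha> (Suc (Suc n)) * cf_denom \<alpha> (Suc n)"
    using partial_quotient_ge_1[of "Suc n"] cf_denom_pos[of "Suc n"] by (intro mult_right_mono) auto
  with ge2(2) have "int (Suc n) \<le> partial_quotient \<alpha> (Suc (Suc n)) * cf_denom \<alpha> (Suc n)" by linarith
  then show ?case using cf_denom_pos[of n] by simp
qed simp

lemma partial_quotient_mult_cf_denom_le:
  "partial_quotient \<alpha> (Suc n) * cf_denom \<alpha> n \<le> cf_denom \<alpha> (Suc n)"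
  using cf_denom_pos by (cases n) (auto simp: less_imp_le)

text \<open>The errors e_n = q_n \<alpha> - p_n obey the recursion of the denominators. Writing the
  induction hypothesis as e_n = - r e_(n+1), with r the complete quotient of index n + 2, leaves
  only the fractional part of r.\<close>

lemma cf_error_Suc:
  "cf_denom \<alpha> (Suc n) * \<alpha> - cf_numer \<alpha> (Suc n) =
     - (cf_denom \<alpha> n * \<alpha> - cf_numer \<alpha> n) * frac (complete_quotient \<alpha> (Suc n))"
proof (induction n)
  case 0
  have "\<alpha> - \<lfloor>\<alpha>\<rfloor> \<noteq> 0" using frac_complete_quotient_pos[of 0] by (simp add: frac_def)
  then show ?case by (simp add: partial_quotient_def frac_def field_simps)
next
  case (Suc n)
  let ?e = "\<lambda>n. cf_denom \<alpha> n * \<alpha> - cf_numer \<alpha> n"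
  let ?r = "complete_quotient \<alpha> (Suc (Suc n))"
  have "?r * frac (complete_quotient \<alpha> (Suc n)) = 1"
    using frac_complete_quotient_pos[of "Suc n"] by simp
  then have e: "?e n = - ?r * ?e (Suc n)" using Suc by algebra
  have "?e (Suc (Suc n)) = of_int \<lfloor>?r\<rfloor> * ?e (Suc n) + ?e n"
    by (simp add: partial_quotient_def algebra_simps)
  also have "\<dots> = - ?e (Suc n) * frac ?r" unfolding e frac_def by algebra
  finally show ?case .
qed

text \<open>The determinant changes sign at each step. Its absolute value carries what coprimality,
  the parity of the denominators and the error bound require.\<close>

lemma cf_det: "\<bar>cf_denom \<alpha> (Suc n) * cf_numer \<alpha> n - cf_denom \<alpha> n * cf_numer \<alpha> (Suc n)\<bar> = 1"
proof (induction n)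
  case (Suc n)
  have "cf_denom \<alpha> (Suc (Suc n)) * cf_numer \<alpha> (Suc n) - cf_denom \<alpha> (Suc n) * cf_numer \<alpha> (Suc (Suc n)) =
    - (cf_denom \<alpha> (Suc n) * cf_numer \<alpha> n - cf_denom \<alpha> n * cf_numer \<alpha> (Suc n))"
    by (simp add: algebra_simps)
  then show ?case using Suc by (simp only: abs_minus_cancel)
qed simp

lemma coprime_cf_numer_denom: "coprime (cf_numer \<alpha> n) (cf_denom \<alpha> n)"
proof (rule coprimeI)
  fix c assume "c dvd cf_numer \<alpha> n" "c dvd cf_denom \<alpha> n"
  then have "c dvd cf_denom \<alpha> (Suc n) * cf_numer \<alpha> n - cf_denom \<alpha> n * cf_numer \<alpha> (Suc n)"
    by (intro dvd_diff) auto
  then have "c dvd \<bar>cf_denom \<alpha> (Suc n) * cf_numer \<alpha> n - cf_denom \<alpha> n * cf_numer \<alpha> (Suc n)\<bar>"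
    by (simp only: dvd_abs_iff)
  then show "is_unit c" unfolding cf_det .
qed

text \<open>Two consecutive even denominators would make the determinant even. Hence odd
  denominators, for which \<open>par_sum\<close> does not vanish, occur infinitely often.\<close>

lemma odd_cf_denom: "odd (cf_denom \<alpha> n) \<or> odd (cf_denom \<alpha> (Suc n))"
proof (rule ccontr)
  assume "\<not> ?thesis"
  then have "even (cf_denom \<alpha> (Suc n) * cf_numer \<alpha> n - cf_denom \<alpha> n * cf_numer \<alpha> (Suc n))"
    by (metis dvd_diff dvd_mult2)
  then have "even \<bar>cf_denom \<alpha> (Suc n) * cf_numer \<alpha> n - cf_denom \<alpha> n * cf_numer \<alpha> (Suc n)\<bar>"
    by (simp only: dvd_abs_iff)
  then show False unfolding cf_det by simp
qed

text \<open>Expressing the determinant through the errors gives \<bar>e_n\<bar> (q_(n+1) + q_n t) =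
  1 with t positive, and q_(n+1) is at least a_(n+1) q_n.\<close>

lemma cf_error_le:
  "partial_quotient \<alpha> (Suc n) * cf_denom \<alpha> n * \<bar>cf_denom \<alpha> n * \<alpha> - cf_numer \<alpha> n\<bar> \<le> 1"
proof -
  let ?e = "\<lambda>n. cf_denom \<alpha> n * \<alpha> - cf_numer \<alpha> n"
  let ?t = "frac (complete_quotient \<alpha> (Suc n))"
  let ?c = "cf_denom \<alpha> (Suc n) + cf_denom \<alpha> n * ?t"
  have "real_of_int (cf_denom \<alpha> (Suc n) * cf_numer \<alpha> n - cf_denom \<alpha> n * cf_numer \<alpha> (Suc n))
      = cf_denom \<alpha> n * ?e (Suc n) - cf_denom \<alpha> (Suc n) * ?e n"
    by (simp add: algebra_simps)
  also have "\<dots> = - (?e n * ?c)" unfolding cf_error_Suc by (simp add: algebra_simps)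
  finally have "\<bar>?e n * ?c\<bar> = \<bar>real_of_int (cf_denom \<alpha> (Suc n) * cf_numer \<alpha> n - cf_denom \<alpha> n * cf_numer \<alpha> (Suc n))\<bar>"
    by (simp only: abs_minus_cancel)
  also have "\<dots> = 1" using arg_cong[OF cf_det, of real_of_int n] by (simp only: of_int_abs of_int_1)
  finally have 1: "\<bar>?e n\<bar> * \<bar>?c\<bar> = 1" by (simp add: abs_mult)
  have "real_of_int (partial_quotient \<alpha> (Suc n) * cf_denom \<alpha> n) \<le> real_of_int (cf_denom \<alpha> (Suc n))"
    unfolding of_int_le_iff by (rule partial_quotient_mult_cf_denom_le)
  also have "\<dots> \<le> ?c" using cf_denom_pos[of n] frac_complete_quotient_pos[of "Suc n"] by simp
  finally have "real_of_int (partial_quotient \<alpha> (Suc n) * cf_denom \<alpha> n) * \<bar>?e n\<bar> \<le> \<bar>?c\<bar> * \<bar>?e n\<bar>"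
    by (intro mult_right_mono) auto
  then show ?thesis using 1 by (simp add: mult_ac)
qed

end

section \<open>Lacunary sequences\<close>

text \<open>Eventually \<bar>b\<bar> grows at least fourfold at each step. Twice the sum of the
  earlier terms then takes up at most two thirds of \<bar>b n\<bar>, apart from a constant, and the
  remaining third outgrows that constant and R.\<close>

lemma lacunary_dominates:
  fixes b :: "nat \<Rightarrow> int" and R :: real
  assumes nz: "\<forall>n\<ge>1. b n \<noteq> 0" and lim: "(\<lambda>n. real_of_int (b n) / real_of_int (b (n + 1))) \<longlonglongrightarrow> 0"
  shows "\<exists>n1. \<forall>n\<ge>n1. R + 2 * (\<Sum>m<n. real_of_int \<bar>b m\<bar>) < real_of_int \<bar>b n\<bar>"
proof -
  have "eventually (\<lambda>n. \<bar>real_of_int (b n) / real_of_int (b (n + 1))\<bar> < 1/4) sequentially"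
    using lim by (auto simp: tendsto_iff dist_real_def dest: spec[of _ "1/4"])
  then obtain L where L0: "\<And>n. n \<ge> L \<Longrightarrow> \<bar>real_of_int (b n) / real_of_int (b (n + 1))\<bar> < 1/4"
    by (auto simp: eventually_sequentially)
  have L: "4 * real_of_int \<bar>b n\<bar> \<le> real_of_int \<bar>b (Suc n)\<bar>" if "n \<ge> L" for n
  proof -
    have "b (Suc n) \<noteq> 0" using nz by auto
    then show ?thesis using L0[OF that] by (simp add: field_simps)
  qed
  \<comment> \<open>The successor makes the index at least 1, so that \<open>b K\<close> is nonzero
    and starts the geometric growth.\<close>
  define K where "K = Suc L"
  let ?D = "\<lambda>n. 2 * (\<Sum>m<n. real_of_int \<bar>b m\<bar>)"
  \<comment> \<open>The constant 2/3 reproduces itself: 2/3 + 2 = 4 * 2/3, and the next term is at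
    least four times as large.\<close>
  have D: "?D n \<le> ?D K + 2/3 * real_of_int \<bar>b n\<bar>" if "n \<ge> K" for n
    using that
  proof (induction n rule: dec_induct)
    case (step n)
    then show ?case using L[of n] by (simp add: K_def)
  qed simp
  have grow: "4 ^ i \<le> real_of_int \<bar>b (K + i)\<bar>" for i
  proof (induction i)
    case 0
    have "b K \<noteq> 0" using nz by (simp add: K_def)
    then have "1 \<le> \<bar>b K\<bar>" by linarith
    then show ?case by simp
  next
    case (Suc i) then show ?case using L[of "K + i"] by (simp add: K_def)
  qed
  obtain i0 where i0: "3 * (\<bar>R\<bar> + ?D K) < 4 ^ i0" using real_arch_pow[of 4] by auto
  have "R + ?D n < real_of_int \<bar>b n\<bar>" if "n \<ge> K + i0" for n
  proof -
    define i where "i = n - K"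
    have n: "n = K + i" "i \<ge> i0" using that by (auto simp: i_def)
    have "(4::real) ^ i0 \<le> 4 ^ i" using n by simp
    also note grow[of i]
    finally have "3 * (\<bar>R\<bar> + ?D K) < real_of_int \<bar>b n\<bar>" using i0 n by simp
    with D[of n] n show ?thesis by simp
  qed
  then show ?thesis by blast
qed

text \<open>Consider the last index t at or above n1 with \<open>d t\<close> nonzero. A late partial
  sum is bounded by R and equals \<open>b t * d t\<close> plus the terms below t, so \<bar>b t\<bar>
  is at most R plus twice the sum of the earlier \<bar>b m\<bar>, against the domination
  hypothesis.\<close>

lemma lacunary_bounded_sum_zero:
  fixes b d :: "nat \<Rightarrow> int"
  assumes nz: "\<And>n. n \<ge> n1 \<Longrightarrow> b n \<noteq> 0"
    and dom: "\<And>n. n \<ge> n1 \<Longrightarrow> R + 2 * (\<Sum>m<n. real_of_int \<bar>b m\<bar>) < real_of_int \<bar>b n\<bar>"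
    and d: "\<And>n. \<bar>d n\<bar> \<le> 2"
    and bd: "\<And>N. N \<ge> N0 \<Longrightarrow> \<bar>real_of_int (\<Sum>n<N. b n * d n)\<bar> \<le> R"
    and const: "\<And>N. N \<ge> N0 \<Longrightarrow> b N * d N = 0"
    and n: "n \<ge> n1"
  shows "d n = 0"
proof (rule ccontr)
  assume "d n \<noteq> 0"
  let ?P = "\<lambda>n. d n \<noteq> 0 \<and> n \<ge> n1"
  have fin: "n < max N0 n1" if "?P n" for n
    using that const[of n] nz[of n] by fastforce
  define t where "t = (GREATEST n. ?P n)"
  have "?P t" unfolding t_def
    by (rule GreatestI_nat[of ?P n "max N0 n1"]) (use \<open>d n \<noteq> 0\<close> n fin in \<open>auto simp: less_imp_le\<close>)
  have above: "d m = 0" if "m > t" for m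
  proof (rule ccontr)
    assume "d m \<noteq> 0"
    with \<open>?P t\<close> that have "?P m" by auto
    then have "m \<le> t" unfolding t_def
      by (rule Greatest_le_nat[of ?P _ "max N0 n1"]) (use fin in \<open>auto simp: less_imp_le\<close>)
    with that show False by simp
  qed
  \<comment> \<open>At this N the bound R is available, and no nonzero term beyond t is
    included.\<close>
  define N where "N = max N0 (Suc t)"
  have "(\<Sum>n<N. b n * d n) = (\<Sum>n<Suc t. b n * d n)"
    by (rule sum.mono_neutral_right) (auto simp: N_def above)
  also have "\<dots> = (\<Sum>n<t. b n * d n) + b t * d t" by simp
  finally have "real_of_int (b t * d t) = real_of_int (\<Sum>n<N. b n * d n) - real_of_int (\<Sum>n<t. b n * d n)"
    by simp
  also have "\<bar>\<dots>\<bar> \<le> R + 2 * (\<Sum>m<t. real_of_int \<bar>b m\<bar>)"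
  proof -
    have "\<bar>\<Sum>n<t. b n * d n\<bar> \<le> (\<Sum>n<t. \<bar>b n\<bar> * 2)"
      by (rule order_trans[OF sum_abs]) (auto intro!: sum_mono mult_left_mono d simp: abs_mult)
    then have "real_of_int \<bar>\<Sum>n<t. b n * d n\<bar> \<le> real_of_int (\<Sum>n<t. \<bar>b n\<bar> * 2)"
      by (simp only: of_int_le_iff)
    also have "\<dots> = 2 * (\<Sum>m<t. real_of_int \<bar>b m\<bar>)" by (simp add: sum_distrib_left mult_ac)
    finally show ?thesis using bd[of N] by (simp only: of_int_abs) (simp add: N_def)
  qed
  also have "\<dots> < real_of_int \<bar>b t\<bar>" using dom \<open>?P t\<close> by blast
  also have "\<dots> \<le> \<bar>real_of_int (b t * d t)\<bar>"
  proof -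
    have "\<bar>b t\<bar> * 1 \<le> \<bar>b t\<bar> * \<bar>d t\<bar>" using \<open>?P t\<close> by (intro mult_left_mono) auto
    then show ?thesis by (simp flip: of_int_abs of_int_mult abs_mult)
  qed
  finally show False by simp
qed

section \<open>Returns in ergodic skew products\<close>

text \<open>In a discrete group singletons are compact, hence of finite mass, and invariance gives
  them all the same mass. If that were zero, the countable group H would be null. This treats every
  subgroup of the integers, including the trivial one, at once.\<close>

lemma haar_measure_on_int:
  fixes H :: "int set"
  assumes m: "haar_measure_on H m" and H: "closed_subgroup H"
  shows "sigma_finite_measure m" "{0} \<in> sets m" "0 < emeasure m {0}"
    and "measurable m borel = measurable (restrict_space borel H) borel"
    and "measurable N m = measurable N (restrict_space borel H)"
proof -
  have sp: "space m = H" and sets: "sets m = sets (restrict_space borel H)"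
    using m by (auto simp: haar_measure_on_def)
  have "sets (borel :: int measure) = UNIV"
    by (auto intro: borel_open Topological_Spaces.open_discrete)
  then have S: "sets m = Pow H" unfolding sets sets_restrict_space by auto
  have fin: "emeasure m {h} < \<infinity>" if "h \<in> H" for h
    using m that by (auto simp: haar_measure_on_def)
  show "sigma_finite_measure m"
  proof
    show "\<exists>A. countable A \<and> A \<subseteq> sets m \<and> \<Union> A = space m \<and> (\<forall>a\<in>A. emeasure m a \<noteq> \<infinity>)"
      by (rule exI[of _ "(\<lambda>h. {h}) ` H"]) (use fin in \<open>auto simp: sp S less_top\<close>)
  qed
  have 0: "0 \<in> H" using H by (simp add: closed_subgroup_def)
  then show "{0} \<in> sets m" by (simp add: S)
  show "0 < emeasure m {0}"
  proof (rule ccontr)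
    assume "\<not> 0 < emeasure m {0}"
    then have z: "emeasure m {0} = 0" by simp
    have inv: "\<And>h B. h \<in> H \<Longrightarrow> B \<in> sets m \<Longrightarrow> emeasure m ((+) h ` B) = emeasure m B"
      using m by (auto simp: haar_measure_on_def)
    have "emeasure m {h} = 0" if "h \<in> H" for h
      using inv[OF that, of "{0}"] z 0 by (simp add: S)
    then have "(\<Union>h\<in>H. {h}) \<in> null_sets m"
      by (intro null_sets_UN') (auto simp: null_sets_def S)
    then show False using m by (auto simp: haar_measure_on_def null_sets_def)
  qed
  show "measurable m borel = measurable (restrict_space borel H) borel"
       "measurable N m = measurable N (restrict_space borel H)"
    using sets by (auto intro!: measurable_cong_sets)
qed

lemma funpow_skew_product:
  fixes \<Psi> :: "'x \<Rightarrow> 'g::comm_monoid_add"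
  shows "(skew_product T \<Psi> ^^ j) (x, h) = ((T ^^ j) x, h + (\<Sum>i<j. \<Psi> ((T ^^ i) x)))"
  by (induction j) (auto simp: skew_product_def add.assoc)

text \<open>The orbit of \<open>B \<times> {0}\<close> is an invariant set of positive measure, so
  its complement is null and it meets \<open>A \<times> {0}\<close>. Travelling from level 0 to
  level 0 means that the sum of \<open>\<Psi>\<close> vanishes. The two alternatives correspond to
  forward and backward orbits.\<close>

lemma ergodic_skew_product_return:
  fixes \<Psi> :: "'x \<Rightarrow> int" and H :: "int set"
  assumes T: "T \<in> measurable M M" "T' \<in> measurable M M"
    and inv: "\<And>x. x \<in> space M \<Longrightarrow> T' (T x) = x" "\<And>x. x \<in> space M \<Longrightarrow> T (T' x) = x"
    and \<Psi>: "\<Psi> \<in> borel_measurable M" "\<forall>x\<in>space M. \<Psi> x \<in> H"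
    and H: "closed_subgroup H" "haar_measure_on H m"
    and erg: "ergodic (M \<Otimes>\<^sub>M m) (skew_product T \<Psi>)"
    and A: "A \<in> sets M" "0 < emeasure M A" and B: "B \<in> sets M" "0 < emeasure M B"
  shows "\<exists>x y j. y = (T ^^ j) x \<and> (\<Sum>i<j. \<Psi> ((T ^^ i) x)) = 0 \<and> (x \<in> A \<and> y \<in> B \<or> x \<in> B \<and> y \<in> A)"
proof -
  note haar = haar_measure_on_int[OF H(2,1)]
  interpret m: sigma_finite_measure m by (rule haar(1))
  let ?N = "M \<Otimes>\<^sub>M m"
  define S where "S = skew_product T \<Psi>"
  define S' where "S' = (\<lambda>(x, h). (T' x, h - \<Psi> (T' x)))"
  have sp: "space m = H" using H by (simp add: haar_measure_on_def)
  have [measurable]: "(\<lambda>h. h) \<in> borel_measurable m"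
    unfolding haar(4) by (rule measurable_restrict_space1) simp
  note [measurable] = T \<Psi>(1)
  have ad: "x + y \<in> H" "x - y \<in> H" if "x \<in> H" "y \<in> H" for x y
  proof -
    show "x + y \<in> H" using H(1) that by (auto simp: closed_subgroup_def)
    have "x + (- y) \<in> H" using H(1) that unfolding closed_subgroup_def by blast
    then show "x - y \<in> H" by simp
  qed
  have T'sp: "T' x \<in> space M" "T x \<in> space M" if "x \<in> space M" for x
    using T[THEN measurable_space] that by auto
  have [measurable]: "(\<lambda>p. snd p + \<Psi> (fst p)) \<in> measurable ?N m"
    unfolding haar(5)
    by (rule measurable_restrict_space2) (use \<Psi>(2) ad in \<open>auto simp: space_pair_measure sp\<close>)
  have "(\<lambda>p. \<Psi> (T' (fst p))) \<in> borel_measurable ?N"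
    by (rule measurable_compose[OF measurable_compose[OF measurable_fst T(2)] \<Psi>(1)])
  moreover have "(uminus :: int \<Rightarrow> int) \<in> borel_measurable borel"
    by (intro borel_measurable_continuous_onI continuous_intros)
  ultimately have "(\<lambda>p. - \<Psi> (T' (fst p))) \<in> borel_measurable ?N"
    by (rule measurable_compose)
  with measurable_compose[OF measurable_snd \<open>(\<lambda>h. h) \<in> borel_measurable m\<close>]
  have "(\<lambda>p. snd p + - \<Psi> (T' (fst p))) \<in> borel_measurable ?N"
    by (rule borel_measurable_add)
  then have [measurable]: "(\<lambda>p. snd p - \<Psi> (T' (fst p))) \<in> borel_measurable ?N"
    by simp
  have [measurable]: "(\<lambda>p. snd p - \<Psi> (T' (fst p))) \<in> measurable ?N m"
    unfolding haar(5)
    by (rule measurable_restrict_space2) (use \<Psi>(2) ad T'sp in \<open>auto simp: space_pair_measure sp\<close>)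
  have S[measurable]: "S \<in> measurable ?N ?N"
    unfolding S_def skew_product_def case_prod_beta by measurable
  have S'[measurable]: "S' \<in> measurable ?N ?N"
    unfolding S'_def case_prod_beta by measurable
  have S'S: "S' (S p) = p" and SS': "S (S' p) = p" if "p \<in> space ?N" for p
    using that inv by (auto simp: S_def S'_def skew_product_def space_pair_measure split: prod.splits)
  have Sj: "(S ^^ j) \<in> measurable ?N ?N" and S'j: "(S' ^^ j) \<in> measurable ?N ?N" for j
    by (rule measurable_compose_n, fact)+
  define P where "P = B \<times> {0 :: int}"
  have P: "P \<in> sets ?N" unfolding P_def using B haar(2) by auto
  \<comment> \<open>Both directions of time are used because \<open>ergodic\<close> asks for exact
    invariance; forward hits alone give only one inclusion.\<close>
  define E where "E = {p \<in> space ?N. \<exists>j. (S ^^ j) p \<in> P \<or> (S' ^^ j) p \<in> P}"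
  have "E = (\<Union>j. ((S ^^ j) -` P \<inter> space ?N) \<union> ((S' ^^ j) -` P \<inter> space ?N))"
    unfolding E_def by blast
  also have "\<dots> \<in> sets ?N"
    using measurable_sets[OF Sj P] measurable_sets[OF S'j P] by (intro sets.countable_UN) blast
  finally have Em: "E \<in> sets ?N" .
  have "S -` E \<inter> space ?N = E"
  proof (intro set_eqI iffI)
    fix p assume "p \<in> S -` E \<inter> space ?N"
    then obtain j where p: "p \<in> space ?N" and j: "(S ^^ j) (S p) \<in> P \<or> (S' ^^ j) (S p) \<in> P"
      by (auto simp: E_def)
    show "p \<in> E"
    proof (cases "(S ^^ j) (S p) \<in> P")
      case True
      then have "(S ^^ Suc j) p \<in> P" by (simp add: funpow_swap1)
      then show ?thesis using p unfolding E_def by blast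
    next
      case False
      with j have "(S' ^^ j) (S p) \<in> P" by simp
      show ?thesis
      proof (cases j)
        case 0 then have "(S ^^ 1) p \<in> P" using j by simp
        then show ?thesis using p unfolding E_def by blast
      next
        case (Suc i)
        then have "(S' ^^ i) p \<in> P" using \<open>(S' ^^ j) (S p) \<in> P\<close> S'S[OF p] by (simp add: funpow_swap1)
        then show ?thesis using p unfolding E_def by blast
      qed
    qed
  next
    fix p assume "p \<in> E"
    then obtain j where p: "p \<in> space ?N" and j: "(S ^^ j) p \<in> P \<or> (S' ^^ j) p \<in> P"
      by (auto simp: E_def)
    have Sp: "S p \<in> space ?N" using measurable_space[OF S p] .
    have "S p \<in> E"
    proof (cases "\<exists>i. j = Suc i \<and> (S ^^ j) p \<in> P")
      case True
      then obtain i where "(S ^^ i) (S p) \<in> P" by (auto simp: funpow_swap1)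
      then show ?thesis using Sp unfolding E_def by blast
    next
      case False
      then have "(S' ^^ j) p \<in> P" using j by (cases j) auto
      then have "(S' ^^ Suc j) (S p) \<in> P" using S'S[OF p] by (simp add: funpow_swap1)
      then show ?thesis using Sp unfolding E_def by blast
    qed
    then show "p \<in> S -` E \<inter> space ?N" using p by simp
  qed
  with erg Em have cases: "emeasure ?N E = 0 \<or> emeasure ?N (space ?N - E) = 0"
    unfolding ergodic_def S_def by blast
  have prod_pos: "0 < emeasure ?N (C \<times> {0})" if "C \<in> sets M" "0 < emeasure M C" for C
    using that haar(2,3) by (simp add: m.emeasure_pair_measure_Times ennreal_zero_less_mult_iff)
  have "P \<subseteq> E"
  proof
    fix p assume p: "p \<in> P"
    then have "(S ^^ 0) p \<in> P" by simp
    moreover have "p \<in> space ?N" using p sets.sets_into_space[OF P] by auto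
    ultimately show "p \<in> E" unfolding E_def by blast
  qed
  then have "emeasure ?N P \<le> emeasure ?N E" using Em by (rule emeasure_mono)
  with prod_pos[OF B] have "emeasure ?N E \<noteq> 0" by (auto simp: P_def)
  with cases have co: "emeasure ?N (space ?N - E) = 0" by simp
  have "\<not> A \<times> {0} \<subseteq> space ?N - E"
  proof
    assume "A \<times> {0} \<subseteq> space ?N - E"
    then have "emeasure ?N (A \<times> {0}) \<le> emeasure ?N (space ?N - E)"
      using Em by (intro emeasure_mono) auto
    with co prod_pos[OF A] show False by simp
  qed
  moreover have "A \<times> {0} \<subseteq> space ?N"
    using A(1) haar(2) by (intro sets.sets_into_space) auto
  ultimately obtain x where x: "x \<in> A" "(x, 0) \<in> E" by auto
  then obtain j where j: "(S ^^ j) (x, 0) \<in> P \<or> (S' ^^ j) (x, 0) \<in> P" and sx: "(x, 0) \<in> space ?N"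
    by (auto simp: E_def)
  from j show ?thesis
  proof
    assume "(S ^^ j) (x, 0) \<in> P"
    then show ?thesis using x unfolding S_def funpow_skew_product P_def by auto
  next
    assume *: "(S' ^^ j) (x, 0) \<in> P"
    then obtain y where y: "y \<in> B" "(S' ^^ j) (x, 0) = (y, 0)" by (auto simp: P_def)
    \<comment> \<open>A backward hit is reversed into a forward orbit that starts in B and ends in
      A.\<close>
    have "(S ^^ j) ((S' ^^ j) p) = p" if "p \<in> space ?N" for p
      using that
    proof (induction j)
      case (Suc i)
      then show ?case
        using SS'[OF measurable_space[OF S'j[of i] Suc.prems]] by (simp add: funpow_swap1)
    qed simp
    from this[OF sx] have "(S ^^ j) (y, 0) = (x, 0)" using y by simp
    then show ?thesis using x y unfolding S_def funpow_skew_product by auto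
  qed
qed

section \<open>Measure on the circle\<close>

lemma space_circle [simp]: "space circle = {0..<1}"
  by (simp add: circle_def space_restrict_space)

lemma sets_circle_iff: "A \<in> sets circle \<longleftrightarrow> A \<subseteq> {0..<1} \<and> A \<in> sets borel"
  unfolding circle_def by (subst sets_restrict_space_iff) auto

lemma emeasure_circle: "A \<subseteq> {0..<1} \<Longrightarrow> emeasure circle A = emeasure lborel A"
  unfolding circle_def by (rule emeasure_restrict_space) auto

lemma AE_circle_iff: "(AE x in circle. P x) \<longleftrightarrow> (AE x in lborel. x \<in> {0..<1} \<longrightarrow> P x)"
  unfolding circle_def by (rule AE_restrict_space_iff) simp

lemma frac_measurable [measurable]: "(frac :: real \<Rightarrow> real) \<in> borel_measurable borel"
  unfolding frac_def[abs_def] by measurable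

lemma rotation_measurable: "rotation \<alpha> \<in> measurable circle circle"
  unfolding circle_def rotation_def[abs_def]
  by (intro measurable_restrict_space2 measurable_restrict_space1) (auto simp: frac_lt_1)

lemma rotation_inverse: "x \<in> {0..<1} \<Longrightarrow> rotation (- \<alpha>) (rotation \<alpha> x) = x"
proof -
  assume x: "x \<in> {0..<1}"
  have "frac (x + \<alpha>) + - \<alpha> = x - of_int \<lfloor>x + \<alpha>\<rfloor>" by (simp add: frac_def)
  then have "rotation (- \<alpha>) (rotation \<alpha> x) = frac (x - of_int \<lfloor>x + \<alpha>\<rfloor>)"
    by (simp only: rotation_def)
  also have "\<dots> = frac x" by (simp add: frac_def)
  finally show ?thesis using x by (simp add: frac_eq)
qed

lemma funpow_rotation:
  "x \<in> {0..<1} \<Longrightarrow> (rotation \<alpha> ^^ j) x = frac (x + of_nat j * \<alpha>)"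
proof (induction j)
  case (Suc j)
  have "frac (x + of_nat j * \<alpha>) + \<alpha> = x + of_nat (Suc j) * \<alpha> - of_int \<lfloor>x + of_nat j * \<alpha>\<rfloor>"
    by (simp add: frac_def algebra_simps)
  then have "frac (frac (x + of_nat j * \<alpha>) + \<alpha>) = frac (x + of_nat (Suc j) * \<alpha> - of_int \<lfloor>x + of_nat j * \<alpha>\<rfloor>)"
    by (simp only:)
  also have "\<dots> = frac (x + of_nat (Suc j) * \<alpha>)" by (simp add: frac_def)
  finally show ?case using Suc by (simp add: rotation_def)
qed (simp add: frac_eq)

lemma null_sets_lborel_translate:
  fixes c :: real
  assumes N: "N \<in> null_sets lborel" shows "{x. x + c \<in> N} \<in> null_sets lborel"
proof -
  have nb[measurable]: "N \<in> sets borel" using N by auto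
  have "0 = emeasure (distr lborel borel ((+) c)) N"
    using N by (subst lborel_distr_plus) auto
  also have "\<dots> = emeasure lborel {x. x + c \<in> N}"
    by (subst emeasure_distr) (auto simp: vimage_def add.commute)
  finally show ?thesis by (auto simp: null_sets_def)
qed

text \<open>At each point the rotation is translation by \<open>\<alpha> - k\<close> for some
  integer k, so the exceptional set lies in countably many translates of a null set.\<close>

lemma AE_rotation:
  assumes "AE x in circle. P x" shows "AE x in circle. P (rotation \<alpha> x)"
proof -
  have "AE y in lborel. y \<in> {0..<1} \<longrightarrow> P y" using assms by (simp add: AE_circle_iff)
  then obtain N where N: "N \<in> null_sets lborel" "{y. \<not> (y \<in> {0..<1} \<longrightarrow> P y)} \<subseteq> N"
    by (auto simp: eventually_ae_filter)
  have "(\<Union>k::int. {x. x + (\<alpha> - of_int k) \<in> N}) \<in> null_sets lborel"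
    by (intro null_sets_UN null_sets_lborel_translate N)
  moreover have "{x \<in> space lborel. \<not> (x \<in> {0..<1} \<longrightarrow> P (rotation \<alpha> x))} \<subseteq> (\<Union>k::int. {x. x + (\<alpha> - of_int k) \<in> N})"
  proof
    fix x assume "x \<in> {x \<in> space lborel. \<not> (x \<in> {0..<1} \<longrightarrow> P (rotation \<alpha> x))}"
    then have "rotation \<alpha> x \<in> N" using N(2) by (auto simp: rotation_def frac_lt_1)
    then have "x + (\<alpha> - of_int \<lfloor>x + \<alpha>\<rfloor>) \<in> N" by (simp add: rotation_def frac_def algebra_simps)
    then show "x \<in> (\<Union>k::int. {x. x + (\<alpha> - of_int k) \<in> N})" by blast
  qed
  ultimately show ?thesis unfolding AE_circle_iff by (rule AE_I')
qed

lemma AE_rotation_orbit: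
  assumes "AE x in circle. P x" shows "AE x in circle. \<forall>j. P ((rotation \<alpha> ^^ j) x)"
proof -
  have "AE x in circle. P ((rotation \<alpha> ^^ j) x)" for j
  proof (induction j)
    case (Suc j)
    from AE_rotation[OF this, of \<alpha>] show ?case by (simp add: funpow_swap1)
  qed (use assms in simp)
  then show ?thesis by (simp add: AE_all_countable)
qed

text \<open>As x runs through the unit interval, at most Q + 2 integers can be close to
  \<open>Q * x + c\<close>. Each accounts for an interval of length
  \<open>2 * \<epsilon> / Q\<close>, and Q + 2 \<le> 3 Q gives the factor 6.\<close>

lemma emeasure_near_integers_le:
  fixes Q :: int and c \<epsilon> :: real
  assumes "Q > 0" "\<epsilon> \<ge> 0"
  shows "emeasure lborel {x \<in> {0..<1}. \<not> (\<epsilon> < frac (Q * x + c) \<and> frac (Q * x + c) < 1 - \<epsilon>)} \<le> ennreal (6 * \<epsilon>)"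
    (is "emeasure lborel ?B \<le> _")
proof -
  let ?K = "{\<lfloor>c\<rfloor>..\<lfloor>c\<rfloor> + Q + 1}"
  let ?I = "\<lambda>k::int. {(k - \<epsilon> - c) / Q .. (k + \<epsilon> - c) / Q}"
  have "?B \<subseteq> (\<Union>k\<in>?K. ?I k)"
  proof
    fix x assume x: "x \<in> ?B"
    define z where "z = Q * x + c"
    have "0 \<le> Q * x" "Q * x < Q" using x assms by auto
    then have z: "\<lfloor>c\<rfloor> \<le> \<lfloor>z\<rfloor>" "\<lfloor>z\<rfloor> \<le> \<lfloor>c\<rfloor> + Q" unfolding z_def by linarith+
    have *: "x \<in> ?I k" if "\<bar>z - k\<bar> \<le> \<epsilon>" for k :: int
      using that assms unfolding z_def by (auto simp: field_simps abs_le_iff)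
    have "frac z \<le> \<epsilon> \<or> 1 - \<epsilon> \<le> frac z" using x by (auto simp: z_def)
    then show "x \<in> (\<Union>k\<in>?K. ?I k)"
    proof
      assume "frac z \<le> \<epsilon>"
      then have "\<bar>z - \<lfloor>z\<rfloor>\<bar> \<le> \<epsilon>" unfolding frac_def by linarith
      with * z show ?thesis by (intro UN_I[of "\<lfloor>z\<rfloor>"]) auto
    next
      assume "1 - \<epsilon> \<le> frac z"
      then have "\<bar>z - (\<lfloor>z\<rfloor> + 1)\<bar> \<le> \<epsilon>" unfolding frac_def by linarith
      with *[of "\<lfloor>z\<rfloor> + 1"] z show ?thesis by (intro UN_I[of "\<lfloor>z\<rfloor> + 1"]) auto
    qed
  qed
  then have "emeasure lborel ?B \<le> emeasure lborel (\<Union>k\<in>?K. ?I k)" by (intro emeasure_mono) auto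
  also have "\<dots> \<le> (\<Sum>k\<in>?K. emeasure lborel (?I k))" by (intro emeasure_subadditive_finite) auto
  also have "\<dots> = (\<Sum>k\<in>?K. ennreal (2 * \<epsilon> / Q))"
  proof (rule sum.cong)
    fix k :: int
    have "(k - \<epsilon> - c) / Q \<le> (k + \<epsilon> - c) / Q" using assms by (intro divide_right_mono) auto
    moreover have "(k + \<epsilon> - c) / Q - (k - \<epsilon> - c) / Q = 2 * \<epsilon> / Q"
      by (simp add: diff_divide_distrib[symmetric])
    ultimately show "emeasure lborel (?I k) = ennreal (2 * \<epsilon> / Q)" by simp
  qed simp
  also have "\<dots> = ennreal (\<Sum>k\<in>?K. 2 * \<epsilon> / Q)" using assms by (intro sum_ennreal) auto
  also have "(\<Sum>k\<in>?K. 2 * \<epsilon> / Q) = of_int (Q + 2) * (2 * \<epsilon> / Q)" using assms by simp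
  also have "\<dots> \<le> ennreal (6 * \<epsilon>)"
  proof (rule ennreal_leI)
    have "of_int (Q + 2) * (2 * \<epsilon>) \<le> of_int (3 * Q) * (2 * \<epsilon>)"
      using assms by (intro mult_right_mono) auto
    then show "of_int (Q + 2) * (2 * \<epsilon> / Q) \<le> 6 * \<epsilon>"
      using assms by (simp add: field_simps)
  qed
  finally show ?thesis .
qed

text \<open>This is a Steinhaus argument. Choose a compact K inside A of positive measure and an
  open U around K with U - K smaller than K. A small translate of K stays inside U, whose measure is
  less than twice that of K, so it overlaps K in positive measure.\<close>

lemma emeasure_Int_translate_pos:
  fixes A :: "real set"
  assumes A: "A \<in> sets borel" "A \<subseteq> {0..<1}" "0 < emeasure lborel A"
  shows "\<exists>d>0. \<forall>h. \<bar>h\<bar> < d \<longrightarrow> 0 < emeasure lborel (A \<inter> {x. x + h \<in> A})"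
proof -
  have bA: "bounded A"
    using A(2) by (intro bounded_subset[OF compact_imp_bounded[OF compact_Icc[of 0 1]]]) auto
  then have Aleb: "A \<in> lmeasurable"
    by (rule bounded_set_imp_lmeasurable) (use A in auto)
  have Apos: "0 < measure lebesgue A"
  proof -
    have "emeasure lborel A = emeasure lebesgue A" using A(1) by simp
    also have "\<dots> = ennreal (measure lebesgue A)" by (rule emeasure_eq_measure2[OF Aleb])
    finally show ?thesis using A(3) by simp
  qed
  obtain K where K: "closed K" "K \<subseteq> A" "A - K \<in> lmeasurable" "emeasure lebesgue (A - K) < ennreal (measure lebesgue A)"
    using sets_lebesgue_inner_closed[OF _ Apos] Aleb by blast
  have "bounded K" using K(2) bA bounded_subset by blast
  with K(1) have Kc: "compact K" by (simp add: compact_eq_bounded_closed)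
  then have Kl: "K \<in> lmeasurable" by (rule lmeasurable_compact)
  have "measure lebesgue (A - K) < measure lebesgue A"
    using K(3,4) by (simp add: emeasure_eq_measure2 ennreal_less_iff)
  then have Kpos: "0 < measure lebesgue K"
    using measurable_measure_Diff[OF Aleb, of K] Kl K(2) by auto
  obtain U where U: "open U" "K \<subseteq> U" "U - K \<in> lmeasurable" "emeasure lebesgue (U - K) < ennreal (measure lebesgue K)"
    using sets_lebesgue_outer_open[OF _ Kpos] Kl by blast
  have Udiff: "measure lebesgue (U - K) < measure lebesgue K"
    using U(3,4) by (simp add: emeasure_eq_measure2 ennreal_less_iff)
  obtain d where d: "d > 0" "(\<Union>x\<in>K. ball x d) \<subseteq> U"
    using compact_subset_open_imp_ball_epsilon_subset[OF Kc U(1,2)] by blast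
  have trans: "{x. x + h \<in> A} \<in> sets borel" for h
  proof -
    have "(\<lambda>x. x + h) -` A \<inter> space borel \<in> sets borel" using A(1) by (intro measurable_sets) auto
    then show ?thesis by (simp add: vimage_def)
  qed
  show ?thesis
  proof (intro exI[of _ d] conjI allI impI d(1))
    fix h :: real assume h: "\<bar>h\<bar> < d"
    let ?L = "(+) (- h) ` K"
    have L: "?L \<in> lmeasurable" "measure lebesgue ?L = measure lebesgue K"
      by (rule measurable_translation[OF Kl], rule measure_translation)
    have "?L \<subseteq> U" using h d(2) by (fastforce simp: dist_real_def)
    have "measure lebesgue (K \<union> ?L) \<le> measure lebesgue (K \<union> (U - K))"
      using \<open>?L \<subseteq> U\<close> Kl L by (intro measure_mono_fmeasurable fmeasurable.Un[OF Kl U(3)]) auto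
    also have "\<dots> \<le> measure lebesgue K + measure lebesgue (U - K)"
      using Kl U(3) by (intro measure_Un_le) auto
    also have "\<dots> < measure lebesgue K + measure lebesgue ?L" using Udiff L(2) by simp
    finally have "0 < measure lebesgue (K \<inter> ?L)" using measure_Un3[OF Kl L(1)] by simp
    then have "0 < emeasure lebesgue (K \<inter> ?L)" by (auto simp: zero_less_measure_iff measure_def enn2real_positive_iff)
    also have "\<dots> \<le> emeasure lebesgue (A \<inter> {x. x + h \<in> A})"
      using K(2) A(1) trans[of h] by (intro emeasure_mono) auto
    also have "\<dots> = emeasure lborel (A \<inter> {x. x + h \<in> A})"
      using A(1) trans[of h] by simp
    finally show "0 < emeasure lborel (A \<inter> {x. x + h \<in> A})" .
  qed
qed

section \<open>The transfer functions\<close>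

text \<open>This is the integer m_N, whose multiple of \<alpha> approximates \<beta> modulo
  1.\<close>

definition approx_index :: "real \<Rightarrow> (nat \<Rightarrow> int) \<Rightarrow> nat \<Rightarrow> int" where
  "approx_index \<alpha> b N = (\<Sum>n<N. b n * cf_denom \<alpha> n)"

text \<open>This is \<delta>_n. The base point x - m_n \<alpha> makes the cohomological equations of
  successive n telescope, because m_(n+1) = m_n + b_n q_n.\<close>

definition transfer_term :: "real \<Rightarrow> (nat \<Rightarrow> int) \<Rightarrow> nat \<Rightarrow> real \<Rightarrow> int" where
  "transfer_term \<alpha> b n x = transfer_F \<alpha> (cf_denom \<alpha> n) (b n) (x - of_int (approx_index \<alpha> b n) * \<alpha>)"

text \<open>The discontinuities of the term \<open>n\<close>, for \<open>\<alpha>\<close> replaced by its convergent, cut the circle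
  into \<open>2 * cf_denom \<alpha> n\<close> cells; a good point is further than \<open>cell_margin\<close> (in units of the cell
  length) from the cell boundaries, which absorbs the error of the replacement.\<close>

definition cell_index :: "real \<Rightarrow> (nat \<Rightarrow> int) \<Rightarrow> nat \<Rightarrow> real \<Rightarrow> int" where
  "cell_index \<alpha> b n x = \<lfloor>of_int (2 * cf_denom \<alpha> n) * (x - of_int (approx_index \<alpha> b n) * \<alpha>)\<rfloor>"

definition cell_margin :: "real \<Rightarrow> (nat \<Rightarrow> int) \<Rightarrow> nat \<Rightarrow> real" where
  "cell_margin \<alpha> b n =
     of_int (2 * cf_denom \<alpha> n * (1 + \<bar>b n\<bar>)) * \<bar>of_int (cf_denom \<alpha> n) * \<alpha> - of_int (cf_numer \<alpha> n)\<bar>"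

definition good_point :: "real \<Rightarrow> (nat \<Rightarrow> int) \<Rightarrow> nat \<Rightarrow> real \<Rightarrow> bool" where
  "good_point \<alpha> b n x \<longleftrightarrow>
     (let z = of_int (2 * cf_denom \<alpha> n) * (x - of_int (approx_index \<alpha> b n) * \<alpha>)
      in cell_margin \<alpha> b n < frac z \<and> frac z < 1 - cell_margin \<alpha> b n)"

context
  fixes \<alpha> :: real and b :: "nat \<Rightarrow> int"
  assumes irrational: "\<alpha> \<notin> \<rat>"
begin

lemma sum_transfer_term_step:
  "(\<Sum>n<N. transfer_term \<alpha> b n (x + \<alpha>) - transfer_term \<alpha> b n x) =
     step_F x - step_F (x - of_int (approx_index \<alpha> b N) * \<alpha>)"
proof (induction N)
  case (Suc N)
  have "transfer_term \<alpha> b N (x + \<alpha>) - transfer_term \<alpha> b N x =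
    step_F (x - of_int (approx_index \<alpha> b N) * \<alpha>) - step_F (x - of_int (approx_index \<alpha> b (Suc N)) * \<alpha>)"
    using transfer_F_step[OF less_imp_le[OF cf_denom_pos[OF irrational]], of \<alpha> N "b N" "x - of_int (approx_index \<alpha> b N) * \<alpha>"]
    by (simp add: transfer_term_def approx_index_def algebra_simps)
  with Suc show ?case by simp
qed (simp add: approx_index_def)

lemma transfer_term_frac: "transfer_term \<alpha> b n (frac x) = transfer_term \<alpha> b n x"
proof -
  have "frac x - c = (x - c) + of_int (- \<lfloor>x\<rfloor>)" for c by (simp add: frac_def)
  then show ?thesis unfolding transfer_term_def by (simp only: transfer_F_add_int)
qed

lemma abs_transfer_term_le: "\<bar>transfer_term \<alpha> b n x\<bar> \<le> \<bar>b n\<bar> * cf_denom \<alpha> n"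
  unfolding transfer_term_def
  by (intro abs_transfer_F_le less_imp_le[OF cf_denom_pos[OF irrational]])

lemma transfer_term_good:
  assumes "good_point \<alpha> b n x"
  shows "transfer_term \<alpha> b n x = b n * par_sum (cf_denom \<alpha> n) (cell_index \<alpha> b n x)"
  unfolding transfer_term_def cell_index_def
  by (rule transfer_F_eq_par_sum[where \<epsilon> = "cell_margin \<alpha> b n" and p = "cf_numer \<alpha> n"])
     (use assms cf_denom_pos[OF irrational] coprime_cf_numer_denom[OF irrational] in
      \<open>auto simp: good_point_def cell_margin_def Let_def\<close>)

text \<open>Translation by one cell flips the parity of the index, hence the sign s_n when q_n is
  odd.\<close>

lemma cell_index_shift:
  "cell_index \<alpha> b n (x + 1 / of_int (2 * cf_denom \<alpha> n)) = cell_index \<alpha> b n x + 1"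
proof -
  have "of_int (2 * cf_denom \<alpha> n) * (x + 1 / of_int (2 * cf_denom \<alpha> n) - c) =
    of_int (2 * cf_denom \<alpha> n) * (x - c) + 1" for c
    using cf_denom_pos[OF irrational, of n] by (simp add: field_simps)
  then show ?thesis by (simp only: cell_index_def one_add_floor)
qed

lemma good_point_sets: "{x \<in> {0..<1}. good_point \<alpha> b n x} \<in> sets borel"
  unfolding good_point_def Let_def by measurable

lemma cell_index_even_sets: "{x. even (cell_index \<alpha> b n x)} \<in> sets borel"
  unfolding cell_index_def by measurable

text \<open>The bad set of index n has measure at most six margins, and the approximation error of
  the convergent bounds this by a multiple of the summable \<bar>b_n\<bar> / a_(n+1).
  Borel--Cantelli applies.\<close>

lemma AE_eventually_good_point:
  assumes nz: "\<forall>n\<ge>1. b n \<noteq> 0"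
    and sm: "summable (\<lambda>n. \<bar>real_of_int (b n)\<bar> / real_of_int (partial_quotient \<alpha> (n + 1)))"
  shows "AE x in circle. eventually (\<lambda>n. good_point \<alpha> b n x) sequentially"
proof -
  let ?A = "\<lambda>n. {x \<in> {0..<1}. \<not> good_point \<alpha> b n x}"
  let ?q = "cf_denom \<alpha>"
  have nonneg: "0 \<le> cell_margin \<alpha> b n" for n
    using cf_denom_pos[OF irrational, of n] by (simp add: cell_margin_def)
  have sets: "?A n \<in> sets circle" for n
  proof -
    have "?A n = {0..<1} - {x \<in> {0..<1}. good_point \<alpha> b n x}" by auto
    then show ?thesis using good_point_sets by (auto simp: sets_circle_iff)
  qed
  have le: "emeasure circle (?A n) \<le> ennreal (6 * cell_margin \<alpha> b n)" for n
  proof -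
    have "of_int (2 * ?q n) * (x - of_int (approx_index \<alpha> b n) * \<alpha>) =
      of_int (2 * ?q n) * x + - of_int (2 * ?q n) * of_int (approx_index \<alpha> b n) * \<alpha>" for x
      by (simp add: algebra_simps)
    then have "?A n = {x \<in> {0..<1}.
        \<not> (cell_margin \<alpha> b n < frac (of_int (2 * ?q n) * x + - of_int (2 * ?q n) * of_int (approx_index \<alpha> b n) * \<alpha>) \<and>
           frac (of_int (2 * ?q n) * x + - of_int (2 * ?q n) * of_int (approx_index \<alpha> b n) * \<alpha>) < 1 - cell_margin \<alpha> b n)}"
      by (simp only: good_point_def Let_def)
    moreover have "emeasure circle (?A n) = emeasure lborel (?A n)" by (rule emeasure_circle) auto
    ultimately show ?thesis
      using emeasure_near_integers_le[of "2 * ?q n" "cell_margin \<alpha> b n", OF _ nonneg]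
        cf_denom_pos[OF irrational, of n]
      by (simp only:) 
  qed
  have "summable (\<lambda>n. measure circle (?A n))"
  proof (rule summable_comparison_test_ev)
    show "summable (\<lambda>n. 24 * (\<bar>real_of_int (b n)\<bar> / real_of_int (partial_quotient \<alpha> (n + 1))))"
      using sm by (rule summable_mult)
    show "eventually (\<lambda>n. norm (measure circle (?A n)) \<le>
        24 * (\<bar>real_of_int (b n)\<bar> / real_of_int (partial_quotient \<alpha> (n + 1)))) sequentially"
    proof (rule eventually_sequentiallyI)
      fix n :: nat assume n: "1 \<le> n"
      define a where "a = real_of_int (partial_quotient \<alpha> (Suc n))"
      define e where "e = ?q n * \<bar>?q n * \<alpha> - cf_numer \<alpha> n\<bar>"
      have a: "1 \<le> a" using partial_quotient_ge_1[OF irrational, of n] by (simp add: a_def)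
      have "a * e \<le> 1" using cf_error_le[OF irrational, of n] by (simp add: a_def e_def mult_ac)
      then have e1: "e \<le> 1 / a" using a by (simp add: field_simps)
      have e0: "0 \<le> e" using cf_denom_pos[OF irrational, of n] by (simp add: e_def)
      have "b n \<noteq> 0" using nz n by auto
      then have "1 \<le> \<bar>b n\<bar>" by linarith
      then have b1: "1 \<le> \<bar>real_of_int (b n)\<bar>" by linarith
      have "measure circle (?A n) \<le> 6 * cell_margin \<alpha> b n"
        unfolding measure_def by (rule enn2real_leI) (use le nonneg in auto)
      also have "\<dots> = 12 * (1 + \<bar>real_of_int (b n)\<bar>) * e"
        by (simp add: cell_margin_def e_def)
      \<comment> \<open>For n \<ge> 1 the integer \<open>b n\<close> is nonzero, so 1 + \<bar>b
        n\<bar> is at most twice \<bar>b n\<bar>.\<close>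
      also have "\<dots> \<le> 12 * (2 * \<bar>real_of_int (b n)\<bar>) * (1 / a)"
        using b1 e1 e0 by (intro mult_mono) auto
      finally show "norm (measure circle (?A n)) \<le>
          24 * (\<bar>real_of_int (b n)\<bar> / real_of_int (partial_quotient \<alpha> (n + 1)))"
        by (simp add: a_def)
    qed
  qed
  moreover have "emeasure circle (?A n) < \<infinity>" for n
    using le[of n] by (simp add: less_top[symmetric] top_unique) (auto simp: top_unique)
  ultimately have "AE x in circle. eventually (\<lambda>n. x \<in> space circle - ?A n) sequentially"
    by (intro borel_cantelli_AE1 sets)
  then show ?thesis by eventually_elim (auto elim: eventually_mono)
qed

end

section \<open>Passage from the approximations m_N \<alpha> to \<beta>\<close>

lemma eventually_step_F_eq:
  fixes y :: "nat \<Rightarrow> real"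
  assumes lim: "(\<lambda>N. infdist (y N - \<beta>) \<int>) \<longlonglongrightarrow> 0" and x: "2 * (x - \<beta>) \<notin> \<int>"
  shows "eventually (\<lambda>N. step_F (x - y N) = step_F (x - \<beta>)) sequentially"
proof -
  define z where "z = 2 * (x - \<beta>)"
  \<comment> \<open>Half the distance from z to the nearest integer, since an error in the argument
    of \<open>step_F\<close> is doubled before the floor is taken.\<close>
  define \<eta> where "\<eta> = min (frac z) (1 - frac z) / 2"
  have ne: "(\<int> :: real set) \<noteq> {}" by auto
  have "0 < frac z" using x by (simp add: z_def frac_gt_0_iff)
  then have \<eta>: "\<eta> > 0" "2 * \<eta> \<le> frac z" "2 * \<eta> \<le> 1 - frac z" using frac_lt_1[of z] by (auto simp: \<eta>_def)
  have "eventually (\<lambda>N. infdist (y N - \<beta>) \<int> < \<eta>) sequentially"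
    using lim \<eta>(1) by (rule order_tendstoD)
  then show ?thesis
  proof eventually_elim
    case (elim N)
    have "\<exists>k\<in>\<int>. dist (y N - \<beta>) k < \<eta>"
    proof (rule ccontr)
      assume "\<not> ?thesis"
      then have "\<eta> \<le> infdist (y N - \<beta>) \<int>"
        unfolding infdist_notempty[OF ne] by (intro cINF_greatest ne) (auto simp: not_less)
      with elim show False by simp
    qed
    then obtain k :: int where k: "\<bar>y N - \<beta> - k\<bar> < \<eta>" by (auto simp: Ints_def dist_real_def)
    have "\<lfloor>2 * (x - y N + of_int k)\<rfloor> = \<lfloor>z\<rfloor>"
    proof (rule floor_unique)
      have z: "2 * (x - y N + of_int k) = z - 2 * (y N - \<beta> - k)" by (simp add: z_def)
      define u where "u = y N - \<beta> - k"
      have u: "u < \<eta>" "- \<eta> < u" using k by (auto simp: u_def abs_less_iff)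
      have fl: "\<lfloor>z\<rfloor> = z - frac z" by (simp add: frac_def)
      show "of_int \<lfloor>z\<rfloor> \<le> 2 * (x - y N + of_int k)"
        unfolding z u_def[symmetric] using fl u \<eta>(2) by linarith
      show "2 * (x - y N + of_int k) < of_int \<lfloor>z\<rfloor> + 1"
        unfolding z u_def[symmetric] using fl u \<eta>(3) by linarith
    qed
    then have "step_F (x - y N + of_int k) = step_F (x - \<beta>)" by (simp add: step_F_eq_par_sign z_def)
    then show ?case by (simp add: step_F_add_int)
  qed
qed

lemma two_step_cocycle: "2 * step_cocycle \<beta> x = step_F (x - \<beta>) - step_F x"
proof -
  have "real_of_int (2 * step_cocycle \<beta> x) = real_of_int (step_F (x - \<beta>) - step_F x)"
    using of_int_step_cocycle[of \<beta> x] by simp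
  then show ?thesis by (simp only: of_int_eq_iff)
qed

lemma step_cocycle_frac: "step_cocycle \<beta> (frac x) = step_cocycle \<beta> x"
proof -
  have "step_F (frac x - c) = step_F (x - c)" for c
    using step_F_add_int[of "x - c" "- \<lfloor>x\<rfloor>"] by (simp add: frac_def algebra_simps)
  from this[of \<beta>] this[of 0] show ?thesis by (simp add: step_cocycle_def)
qed

text \<open>For a fixed j only finitely many points are involved, and at each of them \<beta> may be
  replaced by m_N \<alpha> once N is large. The threshold for N depends on x and j.\<close>

lemma eventually_sum_step_cocycle:
  assumes irr: "\<alpha> \<notin> \<rat>"
    and lim: "sums_mod_1 (\<lambda>n. of_int (b n) * of_int (cf_denom \<alpha> n) * \<alpha>) \<beta>"
    and x: "\<And>i. 2 * (x + of_nat i * \<alpha> - \<beta>) \<notin> \<int>"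
  shows "eventually (\<lambda>N. 2 * (\<Sum>i<j. step_cocycle \<beta> (x + of_nat i * \<alpha>)) =
     - (\<Sum>n<N. transfer_term \<alpha> b n (x + of_nat j * \<alpha>) - transfer_term \<alpha> b n x)) sequentially"
proof (induction j)
  case (Suc j)
  have "(\<lambda>N. infdist (of_int (approx_index \<alpha> b N) * \<alpha> - \<beta>) \<int>) \<longlonglongrightarrow> 0"
    using lim by (simp add: sums_mod_1_def approx_index_def sum_distrib_right)
  from eventually_step_F_eq[OF this x[of j]] Suc show ?case
  proof eventually_elim
    case (elim N)
    let ?y = "x + of_nat j * \<alpha>"
    have *: "x + of_nat (Suc j) * \<alpha> = ?y + \<alpha>" by (simp add: algebra_simps)
    have "2 * step_cocycle \<beta> ?y = - (\<Sum>n<N. transfer_term \<alpha> b n (?y + \<alpha>) - transfer_term \<alpha> b n ?y)"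
      using elim(1) by (simp only: sum_transfer_term_step[OF irr] two_step_cocycle minus_diff_eq)
    with elim(2) show ?case unfolding * by (simp add: sum_subtractf)
  qed
qed simp

section \<open>Non-regularity\<close>

context
  fixes \<alpha> \<beta> :: real and b :: "nat \<Rightarrow> int"
  assumes irrational: "\<alpha> \<notin> \<rat>"
    and nonzero: "\<forall>n\<ge>1. b n \<noteq> 0"
    and expansion: "sums_mod_1 (\<lambda>n. of_int (b n) * of_int (cf_denom \<alpha> n) * \<alpha>) \<beta>"
    and summable_b: "summable (\<lambda>n. \<bar>real_of_int (b n)\<bar> / real_of_int (partial_quotient \<alpha> (n + 1)))"
    and ratio: "(\<lambda>n. real_of_int (b n) / real_of_int (b (n + 1))) \<longlonglongrightarrow> 0"
begin

text \<open>For large N the differences of the transfer terms add up to minus twice the cocycle sum.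
  From M on they are \<open>b n\<close> times a difference of signs, and the terms below M are
  bounded uniformly, so lacunarity applies. It is essential that n1 is chosen before x, y and
  j.\<close>

lemma par_sum_eq_of_bounded_cocycle:
  fixes M :: nat
  shows "\<exists>n1. \<forall>x y j. y = (rotation \<alpha> ^^ j) x \<longrightarrow> x \<in> {0..<1} \<longrightarrow>
     (\<forall>i. 2 * (x + of_nat i * \<alpha> - \<beta>) \<notin> \<int>) \<longrightarrow>
     (\<forall>n\<ge>M. good_point \<alpha> b n x \<and> good_point \<alpha> b n y) \<longrightarrow>
     \<bar>\<Sum>i<j. step_cocycle \<beta> ((rotation \<alpha> ^^ i) x)\<bar> \<le> 2 * int M \<longrightarrow>
     (\<forall>n\<ge>n1. par_sum (cf_denom \<alpha> n) (cell_index \<alpha> b n y) = par_sum (cf_denom \<alpha> n) (cell_index \<alpha> b n x))"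
proof -
  define C where "C = (\<Sum>n<M. 2 * (\<bar>b n\<bar> * cf_denom \<alpha> n))"
  \<comment> \<open>Twice a cocycle sum bounded by 2 M gives 4 M, and C accounts for the terms below
    M.\<close>
  define R where "R = 4 * int M + C"
  obtain n1 where n1: "\<And>n. n \<ge> n1 \<Longrightarrow> real_of_int R + 2 * (\<Sum>m<n. real_of_int \<bar>b m\<bar>) < real_of_int \<bar>b n\<bar>"
    using lacunary_dominates[OF nonzero ratio, of R] by blast
  show ?thesis
  proof (intro exI[of _ "Max {n1, M, 1}"] allI impI)
    fix x y :: real and j n :: nat
    assume y: "y = (rotation \<alpha> ^^ j) x" and x: "x \<in> {0..<1}"
      and reg: "\<forall>i. 2 * (x + of_nat i * \<alpha> - \<beta>) \<notin> \<int>"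
      and good: "\<forall>n\<ge>M. good_point \<alpha> b n x \<and> good_point \<alpha> b n y"
      and bd: "\<bar>\<Sum>i<j. step_cocycle \<beta> ((rotation \<alpha> ^^ i) x)\<bar> \<le> 2 * int M"
      and n: "Max {n1, M, 1} \<le> n"
    let ?s = "\<lambda>n z. par_sum (cf_denom \<alpha> n) (cell_index \<alpha> b n z)"
    let ?t = "\<lambda>n. transfer_term \<alpha> b n y - transfer_term \<alpha> b n x"
    \<comment> \<open>Below M a transfer term need not be a multiple of \<open>b n\<close>; d is
      zero there by convention, and the conclusion is drawn only from M on.\<close>
    define d where "d n = (if n < M then 0 else ?s n y - ?s n x)" for n
    define S where "S = (\<Sum>i<j. step_cocycle \<beta> ((rotation \<alpha> ^^ i) x))"
    have S: "S = (\<Sum>i<j. step_cocycle \<beta> (x + of_nat i * \<alpha>))"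
      unfolding S_def by (simp add: funpow_rotation[OF x] step_cocycle_frac)
    have yf: "y = frac (x + of_nat j * \<alpha>)" unfolding y by (rule funpow_rotation[OF x])
    have "eventually (\<lambda>N. 2 * S = - (\<Sum>n<N. ?t n)) sequentially"
      using eventually_sum_step_cocycle[OF irrational expansion, of x j] reg
      unfolding S yf transfer_term_frac[OF irrational] by blast
    then obtain N0 where N0: "\<And>N. N \<ge> N0 \<Longrightarrow> 2 * S = - (\<Sum>n<N. ?t n)"
      by (auto simp: eventually_sequentially)
    have bt: "b n * d n = ?t n" if "n \<ge> M" for n
      using good that transfer_term_good[OF irrational, of b n] by (simp add: d_def right_diff_distrib)
    have head: "\<bar>\<Sum>n<M. ?t n\<bar> \<le> C"
      unfolding C_def
    proof (rule order_trans[OF sum_abs], rule sum_mono)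
      fix n show "\<bar>?t n\<bar> \<le> 2 * (\<bar>b n\<bar> * cf_denom \<alpha> n)"
        using abs_transfer_term_le[OF irrational, of b n x] abs_transfer_term_le[OF irrational, of b n y] by linarith
    qed
    have "d n = 0"
    proof (rule lacunary_bounded_sum_zero[of "max n1 1" b "real_of_int R" d "max N0 M"])
      show "\<bar>d n\<bar> \<le> 2" for n
        using abs_par_sum_le_1[OF cf_denom_pos[OF irrational], of n "cell_index \<alpha> b n x"]
          abs_par_sum_le_1[OF cf_denom_pos[OF irrational], of n "cell_index \<alpha> b n y"]
        by (auto simp: d_def abs_le_iff)
      \<comment> \<open>The partial sums up to N and up to N + 1 both equal
        \<open>- 2 * S\<close>.\<close>
      show "b N * d N = 0" if "N \<ge> max N0 M" for N
        using N0[of N] N0[of "Suc N"] that bt[of N] by simp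
      show "\<bar>real_of_int (\<Sum>n<N. b n * d n)\<bar> \<le> real_of_int R" if N: "N \<ge> max N0 M" for N
      proof -
        have split: "(\<Sum>n<N. f n) = (\<Sum>n<M. f n) + (\<Sum>n\<in>{M..<N}. f n)" for f :: "nat \<Rightarrow> int"
          using N sum.atLeastLessThan_concat[of 0 M N f] by (simp add: lessThan_atLeast0)
        have "(\<Sum>n<M. b n * d n) = 0" by (simp add: d_def)
        moreover have "(\<Sum>n\<in>{M..<N}. b n * d n) = (\<Sum>n\<in>{M..<N}. ?t n)"
          by (rule sum.cong) (simp_all add: bt)
        ultimately have "(\<Sum>n<N. b n * d n) = (\<Sum>n<N. ?t n) - (\<Sum>n<M. ?t n)"
          using split[of "\<lambda>n. b n * d n"] split[of ?t] by linarith
        also have "(\<Sum>n<N. ?t n) = - 2 * S" using N0[of N] N by simp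
        finally have "\<bar>\<Sum>n<N. b n * d n\<bar> \<le> R"
          using head bd unfolding R_def S_def[symmetric] by linarith
        then show ?thesis by linarith
      qed
      show "real_of_int R + 2 * (\<Sum>m<n. real_of_int \<bar>b m\<bar>) < real_of_int \<bar>b n\<bar>" if "max n1 1 \<le> n" for n
        using n1 that by simp
      show "b n \<noteq> 0" if "max n1 1 \<le> n" for n using nonzero that by simp
    qed (use n in simp)
    then show "?s n y = ?s n x" using n by (simp add: d_def)
  qed
qed

lemma AE_regular_orbit: "AE x in circle. \<forall>i. 2 * (x + of_nat i * \<alpha> - \<beta>) \<notin> \<int>"
proof -
  let ?Z = "\<Union>i::nat. (\<lambda>k. k / 2 - of_nat i * \<alpha> + \<beta>) ` \<int>"
  have "countable ?Z" by (intro countable_UN countable_image) (auto simp: Ints_def)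
  then have "?Z \<in> null_sets lborel" by (rule countable_imp_null_set_lborel)
  then show ?thesis
    unfolding AE_circle_iff
  proof (rule AE_I', intro subsetI)
    fix x assume "x \<in> {x \<in> space lborel. \<not> (x \<in> {0..<1} \<longrightarrow> (\<forall>i. 2 * (x + of_nat i * \<alpha> - \<beta>) \<notin> \<int>))}"
    then obtain i :: nat where i: "2 * (x + of_nat i * \<alpha> - \<beta>) \<in> \<int>" by auto
    have "x = 2 * (x + of_nat i * \<alpha> - \<beta>) / 2 - of_nat i * \<alpha> + \<beta>" by (simp add: field_simps)
    with i show "x \<in> ?Z" by blast
  qed
qed

lemma not_regular_step_cocycle: "\<not> regular_cocycle circle (rotation \<alpha>) (step_cocycle \<beta>)"
proof
  let ?R = "rotation \<alpha>"
  assume "regular_cocycle circle ?R (step_cocycle \<beta>)"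
  then obtain \<Psi> H m g where \<Psi>: "\<Psi> \<in> borel_measurable circle" "\<forall>x\<in>space circle. \<Psi> x \<in> H"
    and H: "closed_subgroup H" "haar_measure_on H m"
    and erg: "ergodic (circle \<Otimes>\<^sub>M m) (skew_product ?R \<Psi>)"
    and g: "g \<in> borel_measurable circle" "AE x in circle. step_cocycle \<beta> x - \<Psi> x = g (?R x) - g x"
    by (auto simp: regular_cocycle_def cohomologous_def coboundary_def)
  \<comment> \<open>The cohomological equation is demanded along the whole forward orbit, so that it
    can be summed up to a return time.\<close>
  define Good where "Good x \<longleftrightarrow> (\<forall>j. step_cocycle \<beta> ((?R ^^ j) x) - \<Psi> ((?R ^^ j) x) = g (?R ((?R ^^ j) x)) - g ((?R ^^ j) x)) \<and>
     (\<forall>i. 2 * (x + of_nat i * \<alpha> - \<beta>) \<notin> \<int>)" for x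
  have "AE x in circle. Good x"
    using AE_rotation_orbit[OF g(2), of \<alpha>] AE_regular_orbit by eventually_elim (simp add: Good_def)
  then obtain Z where Z: "Z \<in> null_sets circle" "{x \<in> {0..<1}. \<not> Good x} \<subseteq> Z"
    by (auto simp: eventually_ae_filter)
  \<comment> \<open>These sets increase with M and cover almost every point, so one of them has
    positive measure.\<close>
  define A where "A M = {x \<in> {0..<1}. \<bar>g x\<bar> \<le> int M \<and> (\<forall>n\<ge>M. good_point \<alpha> b n x)} - Z" for M :: nat
  have A_sets: "A M \<in> sets borel" for M
  proof -
    have "g -` {- int M..int M} \<inter> space circle \<in> sets circle"
      by (rule measurable_sets[OF g(1)]) (auto intro: borel_open Topological_Spaces.open_discrete)
    then have 1: "g -` {- int M..int M} \<inter> {0..<1} \<in> sets borel" by (simp add: sets_circle_iff)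
    have 2: "(\<Inter>n\<in>{M..}. {x \<in> {0..<1}. good_point \<alpha> b n x}) \<in> sets borel"
      by (intro sets.countable_INT' good_point_sets[OF irrational] image_subsetI) auto
    have "A M = (g -` {- int M..int M} \<inter> {0..<1}) \<inter> (\<Inter>n\<in>{M..}. {x \<in> {0..<1}. good_point \<alpha> b n x}) - Z"
      by (auto simp: A_def)
    moreover have "Z \<in> sets borel" using Z(1) by (auto simp: null_sets_def sets_circle_iff)
    ultimately show ?thesis using 1 2 by auto
  qed
  have A_sub: "A M \<subseteq> {0..<1}" for M by (auto simp: A_def)
  have "\<exists>M. 0 < emeasure lborel (A M)"
  proof (rule ccontr)
    assume "\<not> ?thesis"
    then have "A M \<in> null_sets circle" for M
      using A_sets A_sub by (auto simp: null_sets_def sets_circle_iff emeasure_circle)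
    then have "(\<Union>M. A M) \<in> null_sets circle" by (intro null_sets_UN)
    then have "AE x in circle. x \<notin> (\<Union>M. A M)" by (rule AE_not_in)
    moreover have "AE x in circle. x \<notin> Z" using Z(1) by (rule AE_not_in)
    moreover note AE_eventually_good_point[OF irrational nonzero summable_b] AE_space[of circle]
    ultimately have "AE x in circle. False"
    proof eventually_elim
      case (elim x)
      from elim(3) obtain N where N: "\<And>n. n \<ge> N \<Longrightarrow> good_point \<alpha> b n x"
        by (auto simp: eventually_sequentially)
      have "x \<in> A (max N (nat \<bar>g x\<bar>))" using elim N by (auto simp: A_def)
      with elim(1) show ?case by blast
    qed
    then obtain N where "{0..<1} \<subseteq> N" "N \<in> null_sets circle"
      by (auto simp: eventually_ae_filter atLeastLessThan_def lessThan_def atLeast_def Int_def)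
    then have "{0..<1} \<in> null_sets circle"
      using null_sets_subset[of N circle "{0..<1}"] by (simp add: sets_circle_iff)
    then show False by (simp add: null_sets_def emeasure_circle)
  qed
  then obtain M where M: "0 < emeasure lborel (A M)" by blast
  obtain n1 where n1: "\<forall>x y j. y = (?R ^^ j) x \<longrightarrow> x \<in> {0..<1} \<longrightarrow>
     (\<forall>i. 2 * (x + of_nat i * \<alpha> - \<beta>) \<notin> \<int>) \<longrightarrow>
     (\<forall>n\<ge>M. good_point \<alpha> b n x \<and> good_point \<alpha> b n y) \<longrightarrow>
     \<bar>\<Sum>i<j. step_cocycle \<beta> ((?R ^^ i) x)\<bar> \<le> 2 * int M \<longrightarrow>
     (\<forall>n\<ge>n1. par_sum (cf_denom \<alpha> n) (cell_index \<alpha> b n y) = par_sum (cf_denom \<alpha> n) (cell_index \<alpha> b n x))"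
    by (rule exE[OF par_sum_eq_of_bounded_cocycle[of M]]) (rule that)
  have ret: "par_sum (cf_denom \<alpha> n) (cell_index \<alpha> b n y) = par_sum (cf_denom \<alpha> n) (cell_index \<alpha> b n x)"
    if xy: "x \<in> A M" "y \<in> A M" "y = (?R ^^ j) x" and \<Psi>0: "(\<Sum>i<j. \<Psi> ((?R ^^ i) x)) = 0" and n: "n \<ge> n1" for x y j n
  proof (rule n1[rule_format, OF xy(3) _ _ _ _ n])
    have G: "Good x" using xy(1) Z(2) by (auto simp: A_def)
    then show "2 * (x + of_nat i * \<alpha> - \<beta>) \<notin> \<int>" for i by (simp add: Good_def)
    show "x \<in> {0..<1}" using xy by (simp add: A_def)
    show "good_point \<alpha> b n x \<and> good_point \<alpha> b n y" if "n \<ge> M" for n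
      using xy that by (auto simp: A_def)
    have "(\<Sum>i<j. step_cocycle \<beta> ((?R ^^ i) x)) = (\<Sum>i<j. \<Psi> ((?R ^^ i) x) + (g ((?R ^^ Suc i) x) - g ((?R ^^ i) x)))"
      using G by (intro sum.cong) (auto simp: Good_def algebra_simps)
    \<comment> \<open>The sum of \<open>\<Psi>\<close> vanishes and the transfer function
      telescopes; both end values are at most M in absolute value.\<close>
    also have "\<dots> = g y - g x"
      using sum_lessThan_telescope[of "\<lambda>i. g ((?R ^^ i) x)" j] by (simp add: sum.distrib \<Psi>0 xy(3))
    finally show "\<bar>\<Sum>i<j. step_cocycle \<beta> ((?R ^^ i) x)\<bar> \<le> 2 * int M"
      using xy(1,2) by (auto simp: A_def)
  qed
  obtain \<delta> where \<delta>: "\<delta> > 0" "\<And>h. \<bar>h\<bar> < \<delta> \<Longrightarrow> 0 < emeasure lborel (A M \<inter> {x. x + h \<in> A M})"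
    using emeasure_Int_translate_pos[OF A_sets A_sub M] by blast
  \<comment> \<open>As q_n \<ge> n \<ge> k, this choice makes the shift by one cell smaller than
    \<delta>.\<close>
  obtain k :: nat where k: "1 / \<delta> < k" using reals_Archimedean2 by blast
  obtain n where n: "n \<ge> max n1 (max k 1)" "odd (cf_denom \<alpha> n)"
    using odd_cf_denom[OF irrational, of "max n1 (max k 1)"] by (metis le_refl le_SucI)
  define q where "q = cf_denom \<alpha> n"
  define h where "h = 1 / real_of_int (2 * q)"
  have q: "q > 0" "odd q" using cf_denom_pos[OF irrational] n(2) by (auto simp: q_def)
  have "int k \<le> q" using cf_denom_ge[OF irrational, of n] n(1) by (simp add: q_def)
  then have "real k \<le> real_of_int q" by linarith
  with k have "1 / \<delta> < real_of_int (2 * q)" using q(1) by simp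
  then have "\<bar>h\<bar> < \<delta>" using \<delta>(1) q(1) by (simp add: h_def field_simps)
  note pos = \<delta>(2)[OF this]
  define Ev where "Ev = {x \<in> A M. even (cell_index \<alpha> b n x)}"
  define Od where "Od = {x \<in> A M. odd (cell_index \<alpha> b n x)}"
  have "Ev = A M \<inter> {x. even (cell_index \<alpha> b n x)}" "Od = A M - {x. even (cell_index \<alpha> b n x)}"
    by (auto simp: Ev_def Od_def)
  then have EO_sets: "Ev \<in> sets borel" "Od \<in> sets borel"
    using A_sets cell_index_even_sets[OF irrational] by auto
  have shift: "even (cell_index \<alpha> b n (x + h)) \<longleftrightarrow> odd (cell_index \<alpha> b n x)" for x
    using cell_index_shift[OF irrational, of b n x] by (simp add: h_def q_def)
  \<comment> \<open>If x and x + h both lie in \<open>A M\<close>, exactly one of them has even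
    index. The positive overlap is thus covered by E and its translate for either parity class E, so
    neither class is null.\<close>
  have not_null: "0 < emeasure lborel E"
    if E: "E \<in> sets borel" and cover: "A M \<inter> {x. x + h \<in> A M} \<subseteq> E \<union> {x. x + h \<in> E}" for E
  proof (rule ccontr)
    assume "\<not> ?thesis"
    with E have "E \<in> null_sets lborel" by (auto simp: null_sets_def)
    then have "E \<union> {x. x + h \<in> E} \<in> null_sets lborel"
      by (intro null_sets.Un null_sets_lborel_translate)
    then have "emeasure lborel (A M \<inter> {x. x + h \<in> A M}) \<le> 0"
      using cover by (metis (no_types, lifting) emeasure_mono null_setsD1 null_setsD2)
    with pos show False by simp
  qed
  have EO_pos: "0 < emeasure lborel Ev" "0 < emeasure lborel Od"
    by (rule not_null; use EO_sets shift in \<open>auto simp: Ev_def Od_def\<close>)+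
  have sub: "Ev \<subseteq> {0..<1}" "Od \<subseteq> {0..<1}" using A_sub by (auto simp: Ev_def Od_def)
  have circ: "Ev \<in> sets circle" "0 < emeasure circle Ev" "Od \<in> sets circle" "0 < emeasure circle Od"
    using EO_sets EO_pos sub by (auto simp: sets_circle_iff emeasure_circle)
  have inv: "rotation (- \<alpha>) (?R x) = x" "?R (rotation (- \<alpha>) x) = x" if "x \<in> space circle" for x
    using that rotation_inverse[of x \<alpha>] rotation_inverse[of x "- \<alpha>"] by auto
  \<comment> \<open>Ergodicity connects the two parity classes by a return with vanishing
    \<open>\<Psi>\<close>-sum, although such a return preserves the sign.\<close>
  obtain x y j where j: "y = (?R ^^ j) x" "(\<Sum>i<j. \<Psi> ((?R ^^ i) x)) = 0"
    and xy: "x \<in> Ev \<and> y \<in> Od \<or> x \<in> Od \<and> y \<in> Ev"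
    using ergodic_skew_product_return[OF rotation_measurable rotation_measurable inv \<Psi> H erg circ] by blast
  have "par_sum q (cell_index \<alpha> b n y) = par_sum q (cell_index \<alpha> b n x)"
    unfolding q_def by (rule ret[OF _ _ j]) (use xy n(1) in \<open>auto simp: Ev_def Od_def\<close>)
  then show False using xy unfolding par_sum_odd[OF q] by (auto simp: Ev_def Od_def par_sign_def)
qed

end

section \<open>From non-regularity to non-ergodicity\<close>

lemma step_cocycle_measurable: "step_cocycle \<beta> \<in> borel_measurable circle"
proof -
  have "(\<lambda>n::int. n) \<in> measurable (count_space UNIV) borel" by simp
  moreover have "step_cocycle \<beta> \<in> measurable borel (count_space UNIV)"
    unfolding step_cocycle_def[abs_def] step_F_def by measurable
  ultimately have "step_cocycle \<beta> \<in> borel_measurable borel"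
    using measurable_comp[of "step_cocycle \<beta>" borel "count_space UNIV" "\<lambda>n. n" borel] by (simp add: comp_def)
  then show ?thesis unfolding circle_def by (simp add: measurable_restrict_space1)
qed

text \<open>The cocycle is its own representative, with zero transfer function, the whole group as
  subgroup and counting measure as Haar measure. Compact sets of integers are finite, so counting
  measure is finite on them.\<close>

lemma ergodic_imp_regular_cocycle:
  fixes \<Phi> :: "'x \<Rightarrow> int"
  assumes "\<Phi> \<in> borel_measurable M" "ergodic (M \<Otimes>\<^sub>M count_space UNIV) (skew_product T \<Phi>)"
  shows "regular_cocycle M T \<Phi>"
proof -
  have borel: "sets (borel :: int measure) = UNIV"
    by (auto intro: borel_open Topological_Spaces.open_discrete)
  have fin: "finite K" if K: "compact K" for K :: "int set"
  proof -
    obtain F where "F \<subseteq> K" "finite F" "K \<subseteq> (\<Union>k\<in>F. {k})"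
      by (rule compactE_image[OF K, of K "\<lambda>k. {k}"]) (auto simp: Topological_Spaces.open_discrete)
    then show ?thesis by (simp add: finite_subset)
  qed
  have "haar_measure_on UNIV (count_space (UNIV :: int set))"
  proof -
    have "emeasure (count_space UNIV) ((+) h ` A) = emeasure (count_space UNIV) A" for h :: int and A
      by (cases "finite A") (auto simp: emeasure_count_space card_image finite_image_iff)
    then show ?thesis
      unfolding haar_measure_on_def using fin
      by (auto simp: borel sets_restrict_space emeasure_count_space_finite less_top[symmetric])
  qed
  moreover have "cohomologous M T \<Phi> \<Phi>"
    unfolding cohomologous_def coboundary_def by (rule bexI[of _ "\<lambda>_. 0"]) auto
  moreover have "closed_subgroup (UNIV :: int set)" by (simp add: closed_subgroup_def)
  ultimately show ?thesis unfolding regular_cocycle_def using assms by blast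
qed

theorem theorem7p3:
  fixes \<alpha> \<beta> :: real and b :: "nat \<Rightarrow> int"
  assumes "0 \<le> \<alpha>" "\<alpha> < 1" "\<alpha> \<notin> \<rat>"
    and "\<not> bdd_above (partial_quotient \<alpha> ` {1..})"
    and "0 < \<beta>" "\<beta> < 1"
    and "\<forall>k l :: int. \<beta> \<noteq> of_int k * \<alpha> + of_int l"
    and "\<forall>n\<ge>1. b n \<noteq> 0"
    and "sums_mod_1 (\<lambda>n. of_int (b n) * of_int (cf_denom \<alpha> n) * \<alpha>) \<beta>"
    and "summable (\<lambda>n. \<bar>real_of_int (b n)\<bar> / real_of_int (partial_quotient \<alpha> (n + 1)))"
    and "summable (\<lambda>n. (real_of_int (b n) / real_of_int (b (n + 1)))\<^sup>2)"
  shows "\<not> regular_cocycle circle (rotation \<alpha>) (step_cocycle \<beta> :: real \<Rightarrow> int) \<and>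
         \<not> ergodic (circle \<Otimes>\<^sub>M count_space (UNIV :: int set))
             (skew_product (rotation \<alpha>) (step_cocycle \<beta>))"
proof -
  \<comment> \<open>Square-summability enters through the ratios tending to zero, which yields the
    lacunarity of b.\<close>
  have "(\<lambda>n. (real_of_int (b n) / real_of_int (b (n + 1)))\<^sup>2) \<longlonglongrightarrow> 0"
    using assms(11) by (rule summable_LIMSEQ_zero)
  then have "(\<lambda>n. sqrt ((real_of_int (b n) / real_of_int (b (n + 1)))\<^sup>2)) \<longlonglongrightarrow> sqrt 0"
    by (rule tendsto_real_sqrt)
  then have "(\<lambda>n. real_of_int (b n) / real_of_int (b (n + 1))) \<longlonglongrightarrow> 0"
    by (simp only: real_sqrt_abs real_sqrt_zero tendsto_rabs_zero_iff)
  then have "\<not> regular_cocycle circle (rotation \<alpha>) (step_cocycle \<beta>)"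
    by (rule not_regular_step_cocycle[OF assms(3,8,9,10)])
  then show ?thesis using ergodic_imp_regular_cocycle[OF step_cocycle_measurable] by blast
qed

end
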